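(* The automorphism group of $\operatorname{FLim}(\mathcal{KP})$, the Fraïssé limit of the class $\mathcal{KP}$ of finite ordered polyhedra, is extremely amenable.
   Context: A polyhedron is a pair $(A,S_A)$ with $A$ a countable set and $S_A$ a hereditary family of finite subsets of $A$ ($u\subseteq v\in S_A$ implies $u\in S_A$) with $\bigcup S_A=A$. It is viewed as a structure in the signature with one $i$-ary relation symbol $R_i$ for each $i\geq1$, where $(a_1,\dots,a_i)\in R_i$ iff the $a_j$ are distinct and $\{a_1,\dots,a_i\}\in S_A$. An ordered polyhedron is a polyhedron with a total order $<$ on $A$, as a structure in the expanded signature. $\mathcal{KP}$ is the class of finite ordered polyhedra. It is a Fraïssé class; its Fraïssé limit is the unique (up to isomorphism) countable, locally finite, ultrahomogeneous structure whose age (class of finite structures isomorphic to substructures) is $\mathcal{KP}$. A structure is ultrahomogeneous if each isomorphism between finite substructures extends to an automorphism. The automorphism group of a countable structure is a topological group with the topology of pointwise convergence. A topological group $G$ is extremely amenable if for every continuous action of $G$ on a compact space $X$ there is $x\in X$ with $g\cdot x=x$ for all $g\in G$. *)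

theory Defs
  imports "HOL-Analysis.Analysis" "HOL-Algebra.Group_Action"
begin

section \<open>Relational structures\<close>

text \<open>
  Structures over a purely relational signature whose symbols are the elements of the type
  \<open>'s\<close>; the arities are given by a function \<open>ar :: 's \<Rightarrow> nat\<close>. A relation is a set of lists.
\<close>

record ('s, 'a) rel_struct =
  univ :: "'a set"
  rels :: "'s \<Rightarrow> 'a list set"

definition wf_struct :: "('s \<Rightarrow> nat) \<Rightarrow> ('s, 'a) rel_struct \<Rightarrow> bool" where
  "wf_struct ar M \<longleftrightarrow> (\<forall>s. \<forall>xs \<in> rels M s. length xs = ar s \<and> set xs \<subseteq> univ M)"

definition struct_iso :: "('a \<Rightarrow> 'b) \<Rightarrow> ('s, 'a) rel_struct \<Rightarrow> ('s, 'b) rel_struct \<Rightarrow> bool" where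
  "struct_iso f M N \<longleftrightarrow> bij_betw f (univ M) (univ N) \<and>
     (\<forall>s. \<forall>xs \<in> lists (univ M). xs \<in> rels M s \<longleftrightarrow> map f xs \<in> rels N s)"

definition isomorphic_structs :: "('s, 'a) rel_struct \<Rightarrow> ('s, 'b) rel_struct \<Rightarrow> bool" where
  "isomorphic_structs M N \<longleftrightarrow> (\<exists>f. struct_iso f M N)"

definition substruct :: "('s, 'a) rel_struct \<Rightarrow> ('s, 'a) rel_struct \<Rightarrow> bool" where
  "substruct N M \<longleftrightarrow> univ N \<subseteq> univ M \<and> (\<forall>s. rels N s = rels M s \<inter> lists (univ N))"

definition generated_universe :: "('s, 'a) rel_struct \<Rightarrow> 'a set \<Rightarrow> 'a set" where
  "generated_universe M X = \<Inter> {univ N | N. substruct N M \<and> X \<subseteq> univ N}"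

text \<open>
  There are no function symbols, so every subset of the universe carries a substructure and
  the next property always holds; it is kept because it is part of the general
  definition of a Fraisse limit.
\<close>

definition locally_finite_struct :: "('s, 'a) rel_struct \<Rightarrow> bool" where
  "locally_finite_struct M \<longleftrightarrow>
     (\<forall>X. X \<subseteq> univ M \<and> finite X \<longrightarrow> finite (generated_universe M X))"

definition automorphisms :: "('s, 'a) rel_struct \<Rightarrow> ('a \<Rightarrow> 'a) set" where
  "automorphisms M = {g \<in> Bij (univ M). struct_iso g M M}"

definition ultrahomogeneous :: "('s, 'a) rel_struct \<Rightarrow> bool" where
  "ultrahomogeneous M \<longleftrightarrow>
     (\<forall>B C f. substruct B M \<and> substruct C M \<and> finite (univ B) \<and> finite (univ C) \<and> struct_iso f B C
        \<longrightarrow> (\<exists>g \<in> automorphisms M. \<forall>x \<in> univ B. g x = f x))"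

text \<open>
  Classes of finite structures are closed under isomorphism, and every finite structure is
  isomorphic to one whose universe is a set of natural numbers. Such a class is therefore
  represented by the set of its members with universe a set of natural numbers.
\<close>

definition struct_age :: "('s \<Rightarrow> nat) \<Rightarrow> ('s, 'a) rel_struct \<Rightarrow> ('s, nat) rel_struct set" where
  "struct_age ar M =
     {N. wf_struct ar N \<and> finite (univ N) \<and> (\<exists>B. substruct B M \<and> isomorphic_structs N B)}"

definition is_Fraisse_limit ::
  "('s \<Rightarrow> nat) \<Rightarrow> ('s, nat) rel_struct set \<Rightarrow> ('s, 'a) rel_struct \<Rightarrow> bool" where
  "is_Fraisse_limit ar K M \<longleftrightarrow>
     wf_struct ar M \<and> countable (univ M) \<and> locally_finite_struct M \<and> ultrahomogeneous M \<and>
     struct_age ar M = K"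


section \<open>Ordered polyhedra\<close>

definition hereditary_polyhedron :: "'a set \<Rightarrow> 'a set set \<Rightarrow> bool" where
  "hereditary_polyhedron A S \<longleftrightarrow>
     countable A \<and> (\<forall>u \<in> S. finite u) \<and> (\<forall>v \<in> S. \<forall>u. u \<subseteq> v \<longrightarrow> u \<in> S) \<and> \<Union> S = A"

definition ordered_polyhedron :: "'a set \<Rightarrow> 'a set set \<Rightarrow> 'a rel \<Rightarrow> bool" where
  "ordered_polyhedron A S r \<longleftrightarrow>
     hereditary_polyhedron A S \<and> r \<subseteq> A \<times> A \<and> strict_linear_order_on A r"

text \<open>\<open>Simplex n\<close> is the symbol $R_{n+1}$, so that exactly the arities $i \ge 1$ occur.\<close>

datatype polyhedron_symbol = Simplex nat | Less

fun polyhedron_arity :: "polyhedron_symbol \<Rightarrow> nat" where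
  "polyhedron_arity (Simplex n) = Suc n"
| "polyhedron_arity Less = 2"

fun polyhedron_rels :: "'a set set \<Rightarrow> 'a rel \<Rightarrow> polyhedron_symbol \<Rightarrow> 'a list set" where
  "polyhedron_rels S r (Simplex n) = {xs. length xs = Suc n \<and> distinct xs \<and> set xs \<in> S}"
| "polyhedron_rels S r Less = {[x, y] | x y. (x, y) \<in> r}"

definition polyhedron_struct ::
  "'a set \<Rightarrow> 'a set set \<Rightarrow> 'a rel \<Rightarrow> (polyhedron_symbol, 'a) rel_struct" where
  "polyhedron_struct A S r = \<lparr>univ = A, rels = polyhedron_rels S r\<rparr>"

definition KP :: "(polyhedron_symbol, nat) rel_struct set" where
  "KP = {polyhedron_struct A S r | A S r. finite A \<and> ordered_polyhedron A S r}"


section \<open>Automorphism groups and extreme amenability\<close>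

definition Aut_group :: "('s, 'a) rel_struct \<Rightarrow> ('a \<Rightarrow> 'a) monoid" where
  "Aut_group M = (BijGroup (univ M)) \<lparr>carrier := automorphisms M\<rparr>"

definition pointwise_topology :: "('s, 'a) rel_struct \<Rightarrow> ('a \<Rightarrow> 'a) topology" where
  "pointwise_topology M =
     subtopology (product_topology (\<lambda>_. discrete_topology (univ M)) (univ M)) (automorphisms M)"

definition topological_group_on :: "('g, 'b) monoid_scheme \<Rightarrow> 'g topology \<Rightarrow> bool" where
  "topological_group_on G T \<longleftrightarrow>
     group G \<and> topspace T = carrier G \<and>
     continuous_map (prod_topology T T) T (\<lambda>(g, h). g \<otimes>\<^bsub>G\<^esub> h) \<and>
     continuous_map T T (\<lambda>g. inv\<^bsub>G\<^esub> g)"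

definition continuous_action ::
  "('g, 'b) monoid_scheme \<Rightarrow> 'g topology \<Rightarrow> 'x topology \<Rightarrow> ('g \<Rightarrow> 'x \<Rightarrow> 'x) \<Rightarrow> bool" where
  "continuous_action G T X \<phi> \<longleftrightarrow>
     group_action G (topspace X) \<phi> \<and>
     continuous_map (prod_topology T X) X (\<lambda>(g, x). \<phi> g x)"

text \<open>
  HOL cannot quantify over types inside a definition: the type of the points of the compact
  spaces is the first argument, and extreme amenability is the statement for a free type
  variable \<open>'x\<close>. As usual, compact spaces are Hausdorff and nonempty: without the former
  condition, the translation action on the group itself with the indiscrete topology
  would be a fixed point free action of every nontrivial group.
\<close>

definition extremely_amenable ::
  "'x itself \<Rightarrow> ('g, 'b) monoid_scheme \<Rightarrow> 'g topology \<Rightarrow> bool" where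
  "extremely_amenable TYPE('x) G T \<longleftrightarrow>
     topological_group_on G T \<and>
     (\<forall>(X :: 'x topology) \<phi>.
        compact_space X \<and> Hausdorff_space X \<and> topspace X \<noteq> {} \<and> continuous_action G T X \<phi>
        \<longrightarrow> (\<exists>x \<in> topspace X. \<forall>g \<in> carrier G. \<phi> g x = x))"

end

theory Submission
  imports Defs
begin

text \<open>
  By the argument of Kechris, Pestov and Todorcevic, it suffices to show that finite ordered
  polyhedra have the Ramsey property for embeddings.

  Every finite complex is a nerve: send a vertex to the set of faces containing it; then a set of
  vertices is a face iff the corresponding sets have a common element. Hence finite ordered
  polyhedra embed into the cubes whose vertices are the nonempty subsets of \<open>{..<N}\<close> and whose
  simplices are the families with a common point. An embedding of \<open>A\<close> into a cube assigns to each
  coordinate \<open>i < N\<close> a face of \<open>A\<close>, that is, it is a word of length \<open>N\<close> in the faces of \<open>A\<close>.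
  Enumerate the faces colexicographically. The words in which all nonempty faces occur, their first
  occurrences in increasing order, give order preserving embeddings, and if \<open>w\<close> is such a word for
  \<open>B\<close>, then the restriction of its embedding along \<open>j: A \<rightarrow> B\<close> is given by substituting into \<open>w\<close> a
  word \<open>u\<close> that is again of this kind: the first face of \<open>B\<close> whose trace on \<open>A\<close> is \<open>\<sigma>\<close> is \<open>j \<sigma>\<close>
  itself. So the Ramsey property is the Graham-Rothschild theorem on parameter words.
\<close>

section \<open>The Hales-Jewett theorem\<close>

text \<open>The obstacle in Graham-Rothschild is that the part of a word before its first parameter,
  its prefix, has varying length, so the Hales-Jewett theorem does not apply to it directly. The
  induction on the number \<open>k\<close> of parameters therefore has two stages. Once the first
  parameter \<open>a\<close> has occurred it can be treated as a letter: what follows is a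
  \<open>k\<close>-parameter word over \<open>Suc a\<close> letters. Using the induction hypothesis
  repeatedly, one passes to a subspace in which the colour depends on the prefix only. Prefixes of
  all lengths are then made monochromatic by a separate induction that uses only Hales-Jewett. The
  colexicographic order is chosen for two properties. It extends inclusion and is preserved by
  embeddings, so a face whose trace is at least \<open>\<sigma>\<close> cannot come before
  \<open>j \<sigma>\<close>. And the faces below \<open>{v}\<close> contain only vertices below
  \<open>v\<close>, so the first coordinate carrying \<open>{v}\<close> separates \<open>v\<close>
  from every larger vertex; this fixes the order on the cube.\<close>

lemma finite_colours_nat:
  assumes "finite C"
  obtains f :: "'c \<Rightarrow> nat" and r where "inj_on f C" "\<And>x. x \<in> C \<Longrightarrow> f x < r"
proof -
  obtain f :: "'c \<Rightarrow> nat" and n where "f ` C = {i. i < n}" "inj_on f C"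
    using finite_imp_inj_to_nat_seg[OF assms] by blast
  then show ?thesis using that[of f n] by blast
qed

text \<open>A combinatorial line is a list in which \<open>None\<close> marks the moving
  coordinates; this is its point at the letter \<open>c\<close>.\<close>

definition line_at :: "nat option list \<Rightarrow> nat \<Rightarrow> nat list" where
  "line_at l c = map (\<lambda>x. case x of None \<Rightarrow> c | Some d \<Rightarrow> d) l"

definition lines :: "nat \<Rightarrow> nat \<Rightarrow> nat option list set" where
  "lines a n = {l. length l = n \<and> None \<in> set l \<and> (\<forall>d. Some d \<in> set l \<longrightarrow> d < a)}"

definition words :: "nat \<Rightarrow> nat \<Rightarrow> nat list set" where
  "words a n = {x. length x = n \<and> set x \<subseteq> {..<a}}"

lemma line_at_append [simp]: "line_at (k @ l) c = line_at k c @ line_at l c"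
  by (simp add: line_at_def)

lemma line_at_map_Some [simp]: "line_at (map Some x) c = x"
  by (induction x) (auto simp: line_at_def)

lemma length_line_at [simp]: "length (line_at l c) = length l"
  by (simp add: line_at_def)

lemma line_at_in_words: "l \<in> lines a n \<Longrightarrow> c < b \<Longrightarrow> a \<le> b \<Longrightarrow> line_at l c \<in> words b n"
  by (force simp: lines_def words_def line_at_def split: option.splits)

lemma finite_words [simp]: "finite (words a n)"
proof -
  have "words a n = {x. set x \<subseteq> {..<a} \<and> length x = n}" by (auto simp: words_def)
  then show ?thesis using finite_lists_length_eq[of "{..<a}" n] by simp
qed

lemma append_in_words: "x \<in> words a n \<Longrightarrow> y \<in> words a m \<Longrightarrow> x @ y \<in> words a (n + m)"
  by (auto simp: words_def)

definition HJ :: "nat \<Rightarrow> bool" where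
  "HJ a \<longleftrightarrow> (\<forall>r. \<exists>n. \<forall>\<kappa> :: nat list \<Rightarrow> nat. (\<forall>x. \<kappa> x < r) \<longrightarrow>
     (\<exists>l \<in> lines a n. \<exists>k. \<forall>c<a. \<kappa> (line_at l c) = k))"

text \<open>Colour \<open>y\<close> by the whole function sending \<open>x\<close> to the colour of
  \<open>x @ y\<close>. There are finitely many such functions, so Hales-Jewett with more colours
  gives one line that works for all \<open>x\<close> at once.\<close>

lemma HJ_product:
  assumes "HJ a" "a \<ge> 1"
  shows "\<exists>n. \<forall>\<kappa> :: nat list \<Rightarrow> nat. (\<forall>x. \<kappa> x < r) \<longrightarrow>
     (\<exists>l \<in> lines a n. \<forall>x \<in> words b m. \<forall>c<a. \<kappa> (x @ line_at l c) = \<kappa> (x @ line_at l 0))"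
proof -
  let ?C = "words b m \<rightarrow>\<^sub>E {..<r}"
  have "finite ?C" by (intro finite_PiE) auto
  then obtain f :: "(nat list \<Rightarrow> nat) \<Rightarrow> nat" and R where
    f: "inj_on f ?C" "\<And>x. x \<in> ?C \<Longrightarrow> f x < R"
    by (rule finite_colours_nat) blast
  obtain n where n: "\<And>\<kappa> :: nat list \<Rightarrow> nat. (\<forall>x. \<kappa> x < R) \<Longrightarrow>
     (\<exists>l \<in> lines a n. \<exists>k. \<forall>c<a. \<kappa> (line_at l c) = k)"
    using assms(1) unfolding HJ_def by blast
  have "\<exists>l \<in> lines a n. \<forall>x \<in> words b m. \<forall>c<a. \<kappa> (x @ line_at l c) = \<kappa> (x @ line_at l 0)"
    if \<kappa>: "\<forall>x. \<kappa> x < r" for \<kappa> :: "nat list \<Rightarrow> nat"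
  proof -
    define \<xi> where "\<xi> y = (\<lambda>x\<in>words b m. \<kappa> (x @ y))" for y
    have \<xi>: "\<xi> y \<in> ?C" for y using \<kappa> by (auto simp: \<xi>_def)
    obtain l k where l: "l \<in> lines a n" "\<forall>c<a. f (\<xi> (line_at l c)) = k"
      using n[of "\<lambda>y. f (\<xi> y)"] f(2)[OF \<xi>] by blast
    have "\<xi> (line_at l c) = \<xi> (line_at l 0)" if "c < a" for c
      using l(2) that assms(2) \<xi> inj_onD[OF f(1)] by (metis less_le_trans zero_less_one)
    then have "\<kappa> (x @ line_at l c) = \<kappa> (x @ line_at l 0)" if "c < a" "x \<in> words b m" for c x
      using that by (metis \<xi>_def restrict_apply')
    then show ?thesis using l(1) by blast
  qed
  then show ?thesis by blast
qed

text \<open>Colour focusing: \<open>K\<close> is the set of colours of the lines focused at \<open>f\<close>.\<close>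

lemma HJ_focusing:
  assumes "HJ a" "a \<ge> 1"
  shows "\<exists>n. \<forall>\<kappa> :: nat list \<Rightarrow> nat. (\<forall>x. \<kappa> x < r) \<longrightarrow>
     (\<exists>l \<in> lines (Suc a) n. \<exists>k. \<forall>c<Suc a. \<kappa> (line_at l c) = k) \<or>
     (\<exists>K. finite K \<and> card K = s \<and> (\<exists>f \<in> words (Suc a) n. \<forall>k \<in> K. \<exists>l \<in> lines (Suc a) n.
        line_at l a = f \<and> (\<forall>c<a. \<kappa> (line_at l c) = k)))"
proof (induction s)
  case 0
  show ?case
    by (intro exI[of _ 0] allI impI disjI2 exI[of _ "{}"])
       (auto simp: words_def)
next
  case (Suc s)
  then obtain n where n: "\<And>\<kappa> :: nat list \<Rightarrow> nat. (\<forall>x. \<kappa> x < r) \<Longrightarrow>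
     (\<exists>l \<in> lines (Suc a) n. \<exists>k. \<forall>c<Suc a. \<kappa> (line_at l c) = k) \<or>
     (\<exists>K. finite K \<and> card K = s \<and> (\<exists>f \<in> words (Suc a) n. \<forall>k \<in> K. \<exists>l \<in> lines (Suc a) n.
        line_at l a = f \<and> (\<forall>c<a. \<kappa> (line_at l c) = k)))" by blast
  obtain m where m: "\<And>\<kappa> :: nat list \<Rightarrow> nat. (\<forall>x. \<kappa> x < r) \<Longrightarrow>
     (\<exists>l \<in> lines a m. \<forall>x \<in> words (Suc a) n. \<forall>c<a. \<kappa> (x @ line_at l c) = \<kappa> (x @ line_at l 0))"
    using HJ_product[OF assms] by blast
  show ?case
  proof (intro exI[of _ "n + m"] allI impI)
    fix \<kappa> :: "nat list \<Rightarrow> nat" assume \<kappa>: "\<forall>x. \<kappa> x < r"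
    \<comment> \<open>Behind any word \<open>x\<close>, the points of \<open>l\<close> at the
      letters below \<open>a\<close> have the same colour. So \<open>line_at l 0\<close> represents
      them all, and only the letter \<open>a\<close> can behave differently.\<close>
    obtain l where l: "l \<in> lines a m"
      "\<And>x c. x \<in> words (Suc a) n \<Longrightarrow> c < a \<Longrightarrow> \<kappa> (x @ line_at l c) = \<kappa> (x @ line_at l 0)"
      using m[OF \<kappa>] by blast
    have l0: "line_at l 0 \<in> words (Suc a) m" and la: "line_at l a \<in> words (Suc a) m"
      using l(1) by (auto intro: line_at_in_words)
    have fixed: "k @ map Some (line_at l 0) \<in> lines (Suc a) (n + m)" if "k \<in> lines (Suc a) n" for k
      using that l0 by (auto simp: lines_def words_def)
    have diag: "k @ l \<in> lines (Suc a) (n + m)" if "k \<in> lines (Suc a) n" for k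
      using that l(1) by (auto simp: lines_def)
    let ?mono = "\<exists>l \<in> lines (Suc a) (n + m). \<exists>k. \<forall>c<Suc a. \<kappa> (line_at l c) = k"
    consider (mono) k d where "k \<in> lines (Suc a) n" "\<forall>c<Suc a. \<kappa> (line_at k c @ line_at l 0) = d"
      | (focus) K f where "finite K" "card K = s" "f \<in> words (Suc a) n"
          "\<And>d. d \<in> K \<Longrightarrow> \<exists>k \<in> lines (Suc a) n. line_at k a = f \<and> (\<forall>c<a. \<kappa> (line_at k c @ line_at l 0) = d)"
      using n[of "\<lambda>x. \<kappa> (x @ line_at l 0)"] \<kappa> by blast
    then show "?mono \<or> (\<exists>K. finite K \<and> card K = Suc s \<and>
        (\<exists>f \<in> words (Suc a) (n + m). \<forall>k \<in> K. \<exists>l \<in> lines (Suc a) (n + m).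
        line_at l a = f \<and> (\<forall>c<a. \<kappa> (line_at l c) = k)))"
    proof cases
      case mono
      then have "\<forall>c<Suc a. \<kappa> (line_at (k @ map Some (line_at l 0)) c) = d" by simp
      then show ?thesis using fixed[OF mono(1)] by blast
    next
      case focus
      \<comment> \<open>If the colour \<open>e\<close> of the focus is already in \<open>K\<close>,
        the line of that colour becomes monochromatic over \<open>Suc a\<close> letters, the focus
        being its last point. Otherwise \<open>f\<close> followed by the moving \<open>l\<close> is
        a line of the new colour \<open>e\<close>, and the old lines, moving simultaneously with
        \<open>l\<close>, join it at the new focus \<open>f @ line_at l a\<close>.\<close>
      define e where "e = \<kappa> (f @ line_at l 0)"
      show ?thesis
      proof (cases "e \<in> K")
        case True
        then obtain k where k: "k \<in> lines (Suc a) n" "line_at k a = f"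
          "\<forall>c<a. \<kappa> (line_at k c @ line_at l 0) = e"
          using focus(4) by blast
        then have "\<forall>c<Suc a. \<kappa> (line_at (k @ map Some (line_at l 0)) c) = e"
          by (auto simp: less_Suc_eq e_def)
        then show ?thesis using fixed[OF k(1)] by blast
      next
        case False
        have "\<exists>k' \<in> lines (Suc a) (n + m). line_at k' a = f @ line_at l a \<and> (\<forall>c<a. \<kappa> (line_at k' c) = d)"
          if d: "d \<in> insert e K" for d
        proof (cases "d = e")
          case True
          have "map Some f @ l \<in> lines (Suc a) (n + m)"
            using focus(3) l(1) by (auto simp: lines_def words_def)
          moreover have "\<forall>c<a. \<kappa> (line_at (map Some f @ l) c) = e"
            unfolding e_def using l(2)[OF focus(3)] by (metis line_at_append line_at_map_Some)
          ultimately show ?thesis unfolding True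
            by (intro bexI[of _ "map Some f @ l"]) auto
        next
          case False
          then obtain k where k: "k \<in> lines (Suc a) n" "line_at k a = f"
            "\<forall>c<a. \<kappa> (line_at k c @ line_at l 0) = d"
            using focus(4) d by blast
          have "\<kappa> (line_at (k @ l) c) = d" if "c < a" for c
            using k(3) that l(2)[OF line_at_in_words[OF k(1)] that] by simp
          then show ?thesis using diag[OF k(1)] k(2) by (intro bexI[of _ "k @ l"]) auto
        qed
        moreover have "f @ line_at l a \<in> words (Suc a) (n + m)"
          using focus(3) la by (rule append_in_words)
        ultimately have "\<exists>f \<in> words (Suc a) (n + m). \<forall>k \<in> insert e K. \<exists>l \<in> lines (Suc a) (n + m).
            line_at l a = f \<and> (\<forall>c<a. \<kappa> (line_at l c) = k)" by blast
        moreover have "finite (insert e K)" "card (insert e K) = Suc s"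
          using focus(1,2) False by auto
        ultimately show ?thesis by blast
      qed
    qed
  qed
qed

lemma Hales_Jewett: "a \<ge> 1 \<Longrightarrow> HJ a"
proof (induction a rule: dec_induct)
  case base
  have "[None] \<in> lines 1 1" by (auto simp: lines_def)
  then show ?case unfolding HJ_def by (auto intro!: exI[of _ 1] bexI[of _ "[None]"])
next
  case (step a)
  show ?case unfolding HJ_def
  proof
    fix r
    obtain n where n: "\<And>\<kappa> :: nat list \<Rightarrow> nat. (\<forall>x. \<kappa> x < r) \<Longrightarrow>
     (\<exists>l \<in> lines (Suc a) n. \<exists>k. \<forall>c<Suc a. \<kappa> (line_at l c) = k) \<or>
     (\<exists>K. finite K \<and> card K = Suc r \<and> (\<exists>f \<in> words (Suc a) n. \<forall>k \<in> K. \<exists>l \<in> lines (Suc a) n.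
        line_at l a = f \<and> (\<forall>c<a. \<kappa> (line_at l c) = k)))"
      using HJ_focusing[OF step.IH step.hyps(1), of r "Suc r"] by blast
    have "\<exists>l \<in> lines (Suc a) n. \<exists>k. \<forall>c<Suc a. \<kappa> (line_at l c) = k"
      if \<kappa>: "\<forall>x. \<kappa> x < r" for \<kappa> :: "nat list \<Rightarrow> nat"
    proof (rule ccontr)
      assume "\<not> ?thesis"
      then obtain K where K: "finite K" "card K = Suc r"
        "\<And>k. k \<in> K \<Longrightarrow> \<exists>l. \<forall>c<a. \<kappa> (line_at l c) = k"
        using n[OF \<kappa>] by meson
      \<comment> \<open>Every colour in \<open>K\<close> is really attained, at the letter
        \<open>0\<close>, which exists because \<open>a \<ge> 1\<close>. Hence \<open>Suc r\<close>
        colours cannot occur.\<close>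
      have "K \<subseteq> {..<r}" using K(3) \<kappa> step.hyps(1)
        by (metis lessThan_iff less_le_trans subsetI zero_less_one)
      then show False using K(2) card_mono[of "{..<r}" K] by simp
    qed
    then show "\<exists>n. \<forall>\<kappa> :: nat list \<Rightarrow> nat. (\<forall>x. \<kappa> x < r) \<longrightarrow>
       (\<exists>l \<in> lines (Suc a) n. \<exists>k. \<forall>c<Suc a. \<kappa> (line_at l c) = k)" by blast
  qed
qed

section \<open>Parameter words and the Graham-Rothschild theorem\<close>

text \<open>
  A \<open>k\<close>-parameter word over the alphabet \<open>{..<a}\<close>: the letter \<open>a + j\<close> with \<open>j < k\<close> stands for the
  \<open>j\<close>-th parameter. Each parameter occurs, preceded by all smaller ones.
\<close>

definition pwords :: "nat \<Rightarrow> nat \<Rightarrow> nat list set" where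
  "pwords a k = {u. set u \<subseteq> {..<a + k} \<and>
     (\<forall>j<k. \<exists>xs ys. u = xs @ (a + j) # ys \<and> set xs \<subseteq> {..<a + j})}"

text \<open>Composition of parameter words: the parameters of \<open>w\<close> are filled with the
  entries of \<open>u\<close>, which may be letters or parameters. With \<open>subst_assoc\<close>,
  subspaces of subspaces are subspaces.\<close>

definition subst :: "nat \<Rightarrow> nat list \<Rightarrow> nat list \<Rightarrow> nat list" where
  "subst a w u = map (\<lambda>c. if c < a then c else u ! (c - a)) w"

lemma length_subst [simp]: "length (subst a w u) = length w"
  by (simp add: subst_def)

lemma subst_append: "subst a (v @ w) u = subst a v u @ subst a w u"
  by (simp add: subst_def)

lemma subst_cong:
  "(\<And>c. c \<in> set w \<Longrightarrow> a \<le> c \<Longrightarrow> u ! (c - a) = v ! (c - a)) \<Longrightarrow> subst a w u = subst a w v"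
  by (auto simp: subst_def)

lemma subst_assoc:
  "set w \<subseteq> {..<a + length v} \<Longrightarrow> subst a (subst a w v) u = subst a w (subst a v u)"
  by (auto simp: subst_def subset_iff)

lemma pwords_0: "pwords a 0 = lists {..<a}"
  by (auto simp: pwords_def)

lemma set_pwords: "u \<in> pwords a k \<Longrightarrow> set u \<subseteq> {..<a + k}"
  by (simp add: pwords_def)

lemma pwords_first:
  assumes "u \<in> pwords a k" "j < k"
  obtains xs ys where "u = xs @ (a + j) # ys" "set xs \<subseteq> {..<a + j}"
  using assms by (auto simp: pwords_def)

lemma set_subst:
  assumes "set w \<subseteq> {..<a + length u}"
  shows "set (subst a w u) \<subseteq> {..<a} \<union> set u"
  using assms by (fastforce simp: subst_def)

text \<open>If \<open>a + j\<close> first occurs in \<open>u\<close> at position \<open>i\<close>,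
  then it first occurs in the composition where \<open>w\<close> has its first \<open>a + i\<close>:
  before that, \<open>w\<close> only uses parameters with index below \<open>i\<close>, whose values
  are below \<open>a + j\<close>.\<close>

lemma subst_in_pwords:
  assumes w: "w \<in> pwords a m" and u: "u \<in> pwords a k" "length u = m"
  shows "subst a w u \<in> pwords a k"
  unfolding pwords_def
proof (intro CollectI conjI allI impI)
  show "set (subst a w u) \<subseteq> {..<a + k}"
    using set_subst[of w a u] set_pwords[OF w] set_pwords[OF u(1)] u(2) by fastforce
next
  fix j assume "j < k"
  then obtain xs ys where xs: "u = xs @ (a + j) # ys" "set xs \<subseteq> {..<a + j}"
    using pwords_first[OF u(1)] by blast
  have "length xs < m" using xs u(2) by auto
  then obtain xs' ys' where xs': "w = xs' @ (a + length xs) # ys'" "set xs' \<subseteq> {..<a + length xs}"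
    using pwords_first[OF w] by blast
  have "subst a xs' u = subst a xs' xs"
    using xs'(2) by (intro subst_cong) (auto simp: xs(1) nth_append)
  then have "set (subst a xs' u) \<subseteq> {..<a + j}"
    using set_subst[OF xs'(2)] xs(2) by fastforce
  moreover have "subst a w u = subst a xs' u @ (a + j) # subst a ys' u"
    by (simp add: xs' xs subst_def)
  ultimately show "\<exists>xs ys. subst a w u = xs @ (a + j) # ys \<and> set xs \<subseteq> {..<a + j}" by blast
qed

lemma pwords_append:
  assumes "w \<in> pwords a k" "set v \<subseteq> {..<a + k}"
  shows "w @ v \<in> pwords a k"
  unfolding pwords_def
proof (intro CollectI conjI allI impI)
  show "set (w @ v) \<subseteq> {..<a + k}" using set_pwords[OF assms(1)] assms(2) by auto
next
  fix j assume "j < k"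
  then obtain xs ys where "w = xs @ (a + j) # ys" "set xs \<subseteq> {..<a + j}"
    using pwords_first[OF assms(1)] by blast
  then show "\<exists>xs ys. w @ v = xs @ (a + j) # ys \<and> set xs \<subseteq> {..<a + j}"
    by (intro exI[of _ xs] exI[of _ "ys @ v"]) auto
qed

lemma pwords_append_Suc:
  assumes "w \<in> pwords a k" "set v \<subseteq> {..<Suc (a + k)}" "a + k \<in> set v"
  shows "w @ v \<in> pwords a (Suc k)"
  unfolding pwords_def
proof (intro CollectI conjI allI impI)
  show "set (w @ v) \<subseteq> {..<a + Suc k}"
    using set_pwords[OF assms(1)] assms(2) by fastforce
next
  fix j assume j: "j < Suc k"
  show "\<exists>xs ys. w @ v = xs @ (a + j) # ys \<and> set xs \<subseteq> {..<a + j}"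
  proof (cases "j < k")
    case True
    then obtain xs ys where "w = xs @ (a + j) # ys" "set xs \<subseteq> {..<a + j}"
      using pwords_first[OF assms(1)] by blast
    then show ?thesis by (intro exI[of _ xs] exI[of _ "ys @ v"]) auto
  next
    case False
    then have [simp]: "j = k" using j by simp
    obtain xs ys where v: "v = xs @ (a + k) # ys" "a + k \<notin> set xs"
      using split_list_first[OF assms(3)] by blast
    have "set xs \<subseteq> {..<a + k}" using v assms(2) by (force simp: less_Suc_eq)
    then show ?thesis using set_pwords[OF assms(1)]
      by (intro exI[of _ "w @ xs"] exI[of _ ys]) (auto simp: v)
  qed
qed

lemma pwords_Cons:
  assumes "q \<in> pwords (Suc a) k"
  shows "a # q \<in> pwords a (Suc k)"
  unfolding pwords_def
proof (intro CollectI conjI allI impI)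
  show "set (a # q) \<subseteq> {..<a + Suc k}" using set_pwords[OF assms] by auto
next
  fix j assume j: "j < Suc k"
  show "\<exists>xs ys. a # q = xs @ (a + j) # ys \<and> set xs \<subseteq> {..<a + j}"
  proof (cases j)
    case 0
    then show ?thesis by (intro exI[of _ "[]"] exI[of _ q]) auto
  next
    case (Suc i)
    then obtain xs ys where "q = xs @ (Suc a + i) # ys" "set xs \<subseteq> {..<Suc a + i}"
      using pwords_first[OF assms, of i] j by auto
    then show ?thesis using Suc by (intro exI[of _ "a # xs"] exI[of _ ys]) auto
  qed
qed

text \<open>Splits at the first parameter. Behind it, \<open>a\<close> may recur freely, so it
  counts as an additional letter there.\<close>

lemma pwords_SucE:
  assumes "u \<in> pwords a (Suc k)"
  obtains p q where "u = p @ a # q" "set p \<subseteq> {..<a}" "q \<in> pwords (Suc a) k"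
proof -
  obtain p q where p: "u = p @ a # q" "set p \<subseteq> {..<a}"
    using pwords_first[OF assms, of 0] by auto
  have "q \<in> pwords (Suc a) k"
    unfolding pwords_def
  proof (intro CollectI conjI allI impI)
    show "set q \<subseteq> {..<Suc a + k}" using set_pwords[OF assms] p(1) by auto
  next
    fix j assume "j < k"
    then obtain xs ys where xs: "u = xs @ (a + Suc j) # ys" "set xs \<subseteq> {..<a + Suc j}"
      using pwords_first[OF assms, of "Suc j"] by auto
    have "p @ a # q = xs @ (a + Suc j) # ys" using p(1) xs(1) by simp
    then consider us where "p = xs @ us" "us @ a # q = (a + Suc j) # ys"
      | us where "xs = p @ us" "a # q = us @ (a + Suc j) # ys"
      by (auto simp: append_eq_append_conv2)
    then show "\<exists>xs ys. q = xs @ (Suc a + j) # ys \<and> set xs \<subseteq> {..<Suc a + j}"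
    proof cases
      case 1
      then show ?thesis using p(2) by (cases us) auto
    next
      case 2
      then show ?thesis using xs(2) by (cases us) auto
    qed
  qed
  then show ?thesis using that p by blast
qed

text \<open>One application of \<open>HJ_product\<close> per parameter. A line in a fresh block,
  chosen for all words of the earlier block at once, makes the value of the last parameter
  irrelevant; the induction hypothesis takes care of the other parameters.\<close>

lemma Hales_Jewett_subspace:
  assumes "a \<ge> 1"
  shows "\<exists>n. \<forall>\<kappa> :: nat list \<Rightarrow> nat. (\<forall>x. \<kappa> x < r) \<longrightarrow>
    (\<exists>w \<in> pwords a m. length w = n \<and> (\<exists>k. \<forall>u \<in> words a m. \<kappa> (subst a w u) = k))"
proof (induction m)
  case 0
  have "[] \<in> pwords a 0" by (simp add: pwords_0)
  then show ?case by (intro exI[of _ 0] allI impI bexI[of _ "[]"]) (auto simp: words_def subst_def)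
next
  case (Suc m)
  then obtain n where n: "\<And>\<kappa> :: nat list \<Rightarrow> nat. (\<forall>x. \<kappa> x < r) \<Longrightarrow>
    (\<exists>w \<in> pwords a m. length w = n \<and> (\<exists>k. \<forall>u \<in> words a m. \<kappa> (subst a w u) = k))" by blast
  obtain p where p: "\<And>\<kappa> :: nat list \<Rightarrow> nat. (\<forall>x. \<kappa> x < r) \<Longrightarrow>
     (\<exists>l \<in> lines a p. \<forall>x \<in> words a n. \<forall>c<a. \<kappa> (x @ line_at l c) = \<kappa> (x @ line_at l 0))"
    using HJ_product[OF Hales_Jewett[OF assms] assms] by blast
  show ?case
  proof (intro exI[of _ "n + p"] allI impI)
    fix \<kappa> :: "nat list \<Rightarrow> nat" assume \<kappa>: "\<forall>x. \<kappa> x < r"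
    obtain l where l: "l \<in> lines a p"
      "\<And>x c. x \<in> words a n \<Longrightarrow> c < a \<Longrightarrow> \<kappa> (x @ line_at l c) = \<kappa> (x @ line_at l 0)"
      using p[OF \<kappa>] by blast
    obtain w k where w: "w \<in> pwords a m" "length w = n"
      "\<And>u. u \<in> words a m \<Longrightarrow> \<kappa> (subst a w u @ line_at l 0) = k"
      using n[of "\<lambda>x. \<kappa> (x @ line_at l 0)"] \<kappa> by blast
    \<comment> \<open>The moving coordinates of the line are filled with the new last parameter
      \<open>a + m\<close>.\<close>
    define v where "v = w @ line_at l (a + m)"
    have "v \<in> pwords a (Suc m)" unfolding v_def
      using l(1) by (intro pwords_append_Suc[OF w(1)])
        (force simp: lines_def line_at_def image_iff split: option.splits)+
    moreover have "\<kappa> (subst a v u) = k" if u: "u \<in> words a (Suc m)" for u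
    proof -
      have len: "length u = Suc m" and su: "set u \<subseteq> {..<a}" using u by (auto simp: words_def)
      have um: "u ! m < a" using subsetD[OF su nth_mem[of m]] len by simp
      have tk: "take m u \<in> words a m" using len su by (auto simp: words_def dest: in_set_takeD)
      have sw: "set w \<subseteq> {..<a + length (take m u)}"
        using set_pwords[OF w(1)] len by simp
      have "subst a w u = subst a w (take m u)"
        using set_pwords[OF w(1)] by (intro subst_cong) (force simp: len)
      moreover have "subst a (line_at l (a + m)) u = line_at l (u ! m)"
        using l(1) by (force simp: subst_def line_at_def lines_def split: option.splits)
      ultimately have "subst a v u = subst a w (take m u) @ line_at l (u ! m)"
        by (simp add: v_def subst_append)
      moreover have "subst a w (take m u) \<in> words a n"
        using set_subst[OF sw] tk w(2) by (auto simp: words_def)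
      ultimately show ?thesis using l(2)[OF _ um] w(3)[OF tk] by simp
    qed
    ultimately show "\<exists>w \<in> pwords a (Suc m). length w = n + p \<and>
        (\<exists>k. \<forall>u \<in> words a (Suc m). \<kappa> (subst a w u) = k)"
      using w(2) l(1) by (intro bexI[of _ v]) (auto simp: v_def lines_def)
  qed
qed

section \<open>Colouring the part of a word before its first parameter\<close>

definition prefix_word :: "nat \<Rightarrow> nat list \<Rightarrow> nat list" where
  "prefix_word a u = takeWhile (\<lambda>c. c < a) u"

lemma prefix_word_append_Cons [simp]:
  "set p \<subseteq> {..<a} \<Longrightarrow> a \<le> b \<Longrightarrow> prefix_word a (p @ b # q) = p"
  unfolding prefix_word_def by (subst takeWhile_append2) auto

lemma prefix_word_append1: "\<exists>c\<in>set u. a \<le> c \<Longrightarrow> prefix_word a (u @ v) = prefix_word a u"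
  unfolding prefix_word_def by (auto simp: not_less intro!: takeWhile_append1)

lemma set_prefix_word: "set (prefix_word a u) \<subseteq> {..<a}"
  by (auto simp: prefix_word_def dest: set_takeWhileD)

lemma nonletterE:
  assumes "\<exists>c\<in>set u. (a::nat) \<le> c"
  obtains b q where "u = prefix_word a u @ b # q" "a \<le> b"
proof -
  obtain p b q where "u = p @ b # q" "a \<le> b" "\<forall>c \<in> set p. \<not> a \<le> c"
    using split_list_first_prop[OF assms] by blast
  then show ?thesis using that by (metis lessThan_iff not_less prefix_word_append_Cons subsetI)
qed

text \<open>Let \<open>i\<close> be the length of the prefix of \<open>u\<close>. Before its first
  \<open>a + i\<close>, the word \<open>h\<close> only has letters and parameters of index below
  \<open>i\<close>, which receive letters; \<open>a + i\<close> itself receives a nonletter. So the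
  prefix of \<open>subst a h u\<close> ends there, and what follows the prefix of \<open>u\<close>
  may be exchanged for anything that begins with a nonletter.\<close>

lemma prefix_word_subst:
  assumes h: "h \<in> pwords a (length u)" and "\<exists>c\<in>set u. a \<le> c"
    and v: "v = prefix_word a u @ b # q" "a \<le> b"
  shows "prefix_word a (subst a h u) = prefix_word a (subst a h v)"
proof -
  let ?p = "prefix_word a u"
  obtain c r where u: "u = ?p @ c # r" "a \<le> c" using nonletterE[OF assms(2)] .
  then have "length ?p < length u"
    by (metis length_append length_Cons less_add_Suc1 add_Suc_right)
  then obtain xs ys where xs: "h = xs @ (a + length ?p) # ys" "set xs \<subseteq> {..<a + length ?p}"
    using pwords_first[OF h] by blast
  have 1: "subst a xs (?p @ t) = subst a xs ?p" for t
    using xs(2) by (intro subst_cong) (auto simp: nth_append)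
  have 2: "set (subst a xs ?p) \<subseteq> {..<a}"
    using set_subst[OF xs(2)] set_prefix_word[of a u] by blast
  have 3: "prefix_word a (subst a h (?p @ d # t)) = subst a xs ?p" if "a \<le> d" for d t
  proof -
    have "subst a h (?p @ d # t) = subst a xs (?p @ d # t) @ d # subst a ys (?p @ d # t)"
      by (simp add: xs(1) subst_def)
    then show ?thesis using 1 2 that by simp
  qed
  show ?thesis using 3[OF u(2), of r] 3[OF v(2), of q] u(1) v(1) by metis
qed

lemma nonletter_subst:
  assumes h: "h \<in> pwords a (length u)" and "\<exists>c\<in>set u. a \<le> c"
  shows "\<exists>c\<in>set (subst a h u). a \<le> c"
proof -
  obtain j where j: "j < length u" "a \<le> u ! j" using assms(2) by (auto simp: in_set_conv_nth)
  then obtain xs ys where "h = xs @ (a + j) # ys" using pwords_first[OF h] by metis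
  then show ?thesis using j by (auto simp: subst_def)
qed

text \<open>Brings words of bounded length to a prescribed length. The padding is the letter
  \<open>0\<close>, hence \<open>a \<ge> 1\<close>; standing at the end, it leaves prefixes alone,
  as \<open>prefix_word_pad\<close> shows.\<close>

lemma pad_pwords:
  assumes "a \<ge> 1" "g \<in> pwords a m" "length g \<le> n"
  shows "g @ replicate (n - length g) 0 \<in> pwords a m" "length (g @ replicate (n - length g) 0) = n"
  using assms by (auto intro!: pwords_append)

lemma prefix_word_pad:
  assumes "g \<in> pwords a (length u)" "\<exists>c\<in>set u. a \<le> c"
  shows "prefix_word a (subst a (g @ z) u) = prefix_word a (subst a g u)"
  using prefix_word_append1[OF nonletter_subst[OF assms]] by (simp add: subst_append)

text \<open>The off-diagonal form, with a separate dimension \<open>m c\<close> for each colour \<open>c\<close>, makes the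
  induction on the sum of the dimensions work.\<close>

lemma prefix_colouring:
  assumes a: "a \<ge> 1"
  shows "(\<Sum>c<r. m c) = s \<Longrightarrow> \<exists>n. \<forall>\<psi> :: nat list \<Rightarrow> nat. (\<forall>x. \<psi> x < r) \<longrightarrow>
    (\<exists>c<r. \<exists>g \<in> pwords a (m c). length g \<le> n \<and>
      (\<forall>u. length u = m c \<longrightarrow> (\<exists>x\<in>set u. a \<le> x) \<longrightarrow> \<psi> (prefix_word a (subst a g u)) = c))"
proof (induction s arbitrary: m)
  case s: (0 m)
  have "[] \<in> pwords a 0" by (simp add: pwords_0)
  moreover have "m c = 0" if "c < r" for c using s that by simp
  ultimately have "\<exists>g \<in> pwords a (m c). length g \<le> 0 \<and> (\<forall>u. length u = m c \<longrightarrow>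
      (\<exists>x\<in>set u. a \<le> x) \<longrightarrow> \<psi> (prefix_word a (subst a g u)) = c)" if "c < r" for c \<psi>
    using that by (intro bexI[of _ "[]"]) auto
  then show ?case by blast
next
  case (Suc s m)
  show ?case
  proof (cases "\<exists>c<r. m c = 0")
    case True
    then obtain c where c: "c < r" "m c = 0" by blast
    have "[] \<in> pwords a (m c)" by (simp add: c(2) pwords_0)
    then have "\<exists>g \<in> pwords a (m c). length g \<le> 0 \<and> (\<forall>u. length u = m c \<longrightarrow>
        (\<exists>x\<in>set u. a \<le> x) \<longrightarrow> \<psi> (prefix_word a (subst a g u)) = c)" for \<psi>
      using c by (intro bexI[of _ "[]"]) auto
    then show ?thesis using c(1) by blast
  next
    case False
    define P where "P m' n \<longleftrightarrow> (\<forall>\<psi> :: nat list \<Rightarrow> nat. (\<forall>x. \<psi> x < r) \<longrightarrow>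
      (\<exists>c<r. \<exists>g \<in> pwords a (m' c). length g \<le> n \<and>
        (\<forall>u. length u = m' c \<longrightarrow> (\<exists>x\<in>set u. a \<le> x) \<longrightarrow>
          \<psi> (prefix_word a (subst a g u)) = c)))" for m' n
    have "\<exists>n. P (m(d := m d - 1)) n" if "d < r" for d
      unfolding P_def
    proof (rule Suc.IH)
      have "m d > 0" using False that by auto
      have "(\<Sum>c<r. m c) = m d + (\<Sum>c\<in>{..<r} - {d}. m c)"
        using that by (simp add: sum.remove)
      moreover have "(\<Sum>c<r. (m(d := m d - 1)) c) = (m d - 1) + (\<Sum>c\<in>{..<r} - {d}. m c)"
        using that by (simp add: sum.remove[of "{..<r}" d])
      ultimately show "(\<Sum>c<r. (m(d := m d - 1)) c) = s"
        using Suc.prems \<open>m d > 0\<close> by linarith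
    qed
    then obtain n where n: "\<And>d. d < r \<Longrightarrow> P (m(d := m d - 1)) (n d)" by metis
    \<comment> \<open>The colour \<open>d\<close> whose dimension gets lowered is known only after
      \<open>h\<close> has been chosen, so the dimension \<open>N\<close> of \<open>h\<close> has to
      serve every \<open>d\<close>.\<close>
    define N where "N = (\<Sum>d<r. n d)"
    have nN: "n d \<le> N" if "d < r" for d
      unfolding N_def using that by (intro member_le_sum) auto
    obtain n1 where n1: "\<And>\<kappa> :: nat list \<Rightarrow> nat. (\<forall>x. \<kappa> x < r) \<Longrightarrow>
        \<exists>w \<in> pwords a N. length w = n1 \<and> (\<exists>k. \<forall>u \<in> words a N. \<kappa> (subst a w u) = k)"
      using Hales_Jewett_subspace[OF a, of r N] by blast
    show ?thesis
    proof (rule exI[of _ "Suc n1"], intro allI impI)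
      fix \<psi> :: "nat list \<Rightarrow> nat" assume \<psi>: "\<forall>x. \<psi> x < r"
      obtain h k where h: "h \<in> pwords a N" "length h = n1"
        "\<And>u. u \<in> words a N \<Longrightarrow> \<psi> (subst a h u) = k" using n1[OF \<psi>] by blast
      \<comment> \<open>All letter-only words in the subspace \<open>h\<close> have colour
        \<open>d\<close>. They will provide one further parameter for this colour, which is why the
        induction hypothesis is applied with \<open>m d\<close> lowered by one.\<close>
      define d where "d = \<psi> (subst a h (replicate N 0))"
      have "d < r" using \<psi> by (simp add: d_def)
      have "replicate N 0 \<in> words a N" using a by (auto simp: words_def)
      then have hd: "\<psi> (subst a h u) = d" if "u \<in> words a N" for u
        using h(3) that by (simp add: d_def)
      \<comment> \<open>The colour induced on prefixes inside \<open>h\<close>. Some nonletter must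
        follow \<open>x\<close> to end the prefix; by \<open>prefix_word_subst\<close> the
        continuation chosen here is immaterial.\<close>
      define \<psi>' where "\<psi>' x = \<psi> (prefix_word a (subst a h (x @ a # replicate (N - length x - 1) a)))" for x
      obtain c g where c: "c < r" and g: "g \<in> pwords a ((m(d := m d - 1)) c)" "length g \<le> n d"
        and gc: "\<And>u. length u = (m(d := m d - 1)) c \<Longrightarrow> \<exists>x\<in>set u. a \<le> x \<Longrightarrow>
          \<psi>' (prefix_word a (subst a g u)) = c"
        using n[OF \<open>d < r\<close>, unfolded P_def, rule_format, of \<psi>'] \<psi> unfolding \<psi>'_def by blast
      define f where "f = g @ replicate (N - length g) 0"
      define m' where "m' = (m(d := m d - 1)) c"
      have f: "f \<in> pwords a m'" "length f = N"
        using pad_pwords[OF a, of g m' N] g nN[OF \<open>d < r\<close>] by (auto simp: f_def m'_def)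
      define e where "e = subst a h f"
      have e: "e \<in> pwords a m'" "length e = n1"
        using subst_in_pwords[OF h(1) f] h(2) by (auto simp: e_def)
      have assoc: "subst a e u = subst a h (subst a f u)" for u
        unfolding e_def using set_pwords[OF h(1)] by (intro subst_assoc) (simp add: f(2))
      have ec: "\<psi> (prefix_word a (subst a e u)) = c" if u: "length u = m'" "\<exists>x\<in>set u. a \<le> x" for u
      proof -
        let ?x = "subst a f u" and ?p = "prefix_word a (subst a f u)"
        have "f \<in> pwords a (length u)" using f u by simp
        then have x: "\<exists>x\<in>set ?x. a \<le> x" using u(2) by (rule nonletter_subst)
        have "?p = prefix_word a (subst a g u)"
          unfolding f_def using g(1) u by (intro prefix_word_pad) (auto simp: m'_def)
        then have "\<psi>' ?p = c" using gc u by (simp add: m'_def)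
        moreover have "prefix_word a (subst a h ?x) =
            prefix_word a (subst a h (?p @ a # replicate (N - length ?p - 1) a))"
          using h(1) f x by (intro prefix_word_subst) auto
        ultimately show ?thesis by (simp add: assoc \<psi>'_def)
      qed
      show "\<exists>c<r. \<exists>g \<in> pwords a (m c). length g \<le> Suc n1 \<and>
        (\<forall>u. length u = m c \<longrightarrow> (\<exists>x\<in>set u. a \<le> x) \<longrightarrow> \<psi> (prefix_word a (subst a g u)) = c)"
      proof (cases "c = d")
        case False
        then have "m' = m c" by (simp add: m'_def)
        then show ?thesis using c e ec by (intro exI[of _ c] conjI bexI[of _ e]) auto
      next
        case [simp]: True
        have mc: "m c = Suc m'" using \<open>\<not> (\<exists>c<r. m c = 0)\<close> c by (simp add: m'_def)
        \<comment> \<open>The further parameter is put at the end. If it is the only one to receive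
          a nonletter, the prefix is all of \<open>subst a e u'\<close>, a letter-only word in the
          subspace \<open>h\<close>, and has colour \<open>d\<close>. In all other cases the prefix
          ends inside \<open>subst a e u'\<close> and \<open>ec\<close> applies.\<close>
        let ?g = "e @ [a + m']"
        have "?g \<in> pwords a (m c)" unfolding mc by (rule pwords_append_Suc[OF e(1)]) auto
        moreover have "\<psi> (prefix_word a (subst a ?g u)) = c" if u: "length u = m c" "\<exists>x\<in>set u. a \<le> x" for u
        proof -
          obtain u' z where u': "u = u' @ [z]" "length u' = m'"
            using u(1) mc by (metis length_Suc_conv_rev)
          have eu: "subst a e u = subst a e u'"
            using set_pwords[OF e(1)] u' by (intro subst_cong) (fastforce simp: nth_append)
          then have gu: "subst a ?g u = subst a e u' @ [z]"
            using u' by (simp add: subst_append) (simp add: subst_def nth_append)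
          show ?thesis
          proof (cases "\<exists>x\<in>set u'. a \<le> x")
            case True
            then have "prefix_word a (subst a ?g u) = prefix_word a (subst a e u')"
              unfolding gu using e(1) u' by (intro prefix_word_append1 nonletter_subst) auto
            then show ?thesis using ec[OF u'(2) True] by simp
          next
            case False
            then have su: "set u' \<subseteq> {..<a}" and z: "a \<le> z" using u(2) u'(1) by auto
            have "set (subst a f u') \<subseteq> {..<a}"
              using set_subst[of f a u'] set_pwords[OF f(1)] su u'(2) by auto
            then have fu: "subst a f u' \<in> words a N" using f(2) by (auto simp: words_def)
            have "set (subst a e u') \<subseteq> {..<a}"
              using set_subst[of e a u'] set_pwords[OF e(1)] su u'(2) by auto
            then have "prefix_word a (subst a ?g u) = subst a e u'"
              unfolding gu using z by simp
            then show ?thesis using hd[OF fu] assoc by simp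
          qed
        qed
        ultimately show ?thesis using c e(2) by (intro exI[of _ c] conjI bexI[of _ ?g]) auto
      qed
    qed
  qed
qed

section \<open>The Graham-Rothschild theorem\<close>

definition GR :: "nat \<Rightarrow> nat \<Rightarrow> bool" where
  "GR a k \<longleftrightarrow> (\<forall>r m. \<exists>n. \<forall>\<kappa> :: nat list \<Rightarrow> nat. (\<forall>x. \<kappa> x < r) \<longrightarrow>
    (\<exists>w \<in> pwords a m. length w = n \<and>
      (\<exists>c. \<forall>u \<in> pwords a k. length u = m \<longrightarrow> \<kappa> (subst a w u) = c)))"

text \<open>Makes the colour independent of everything behind the first parameter. The induction on
  \<open>m\<close> looks at the first entry of the substituted word: if it is the parameter
  \<open>a\<close>, the prefix is empty and \<open>GR (Suc a) k\<close> applies to the rest; if it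
  is a letter, the induction hypothesis is used for all letters simultaneously.\<close>

lemma GR_fusion:
  assumes GR: "GR (Suc a) k"
  shows "\<exists>n. \<forall>\<kappa> :: nat list \<Rightarrow> nat. (\<forall>x. \<kappa> x < r) \<longrightarrow>
    (\<exists>w \<in> pwords a m. length w = n \<and>
      (\<forall>p q q'. set p \<subseteq> {..<a} \<longrightarrow> q \<in> pwords (Suc a) k \<longrightarrow> q' \<in> pwords (Suc a) k \<longrightarrow>
        length (p @ a # q) = m \<longrightarrow> length (p @ a # q') = m \<longrightarrow>
        \<kappa> (subst a w (p @ a # q)) = \<kappa> (subst a w (p @ a # q'))))"
proof (induction m arbitrary: r)
  case 0
  have "[] \<in> pwords a 0" by (simp add: pwords_0)
  then show ?case by (intro exI[of _ 0] allI impI bexI[of _ "[]"]) auto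
next
  case (Suc m)
  let ?C = "{..<a} \<rightarrow>\<^sub>E {..<r}"
  have "finite ?C" by (intro finite_PiE) auto
  then obtain F :: "(nat \<Rightarrow> nat) \<Rightarrow> nat" and R where
    F: "inj_on F ?C" "\<And>x. x \<in> ?C \<Longrightarrow> F x < R"
    by (rule finite_colours_nat) blast
  obtain N where N: "\<And>\<kappa> :: nat list \<Rightarrow> nat. (\<forall>x. \<kappa> x < R) \<Longrightarrow>
    (\<exists>w \<in> pwords a m. length w = N \<and>
      (\<forall>p q q'. set p \<subseteq> {..<a} \<longrightarrow> q \<in> pwords (Suc a) k \<longrightarrow> q' \<in> pwords (Suc a) k \<longrightarrow>
        length (p @ a # q) = m \<longrightarrow> length (p @ a # q') = m \<longrightarrow>
        \<kappa> (subst a w (p @ a # q)) = \<kappa> (subst a w (p @ a # q'))))" using Suc.IH[of R] by blast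
  obtain n where n: "\<And>\<kappa> :: nat list \<Rightarrow> nat. (\<forall>x. \<kappa> x < r) \<Longrightarrow>
    (\<exists>w \<in> pwords (Suc a) N. length w = n \<and>
      (\<exists>c. \<forall>u \<in> pwords (Suc a) k. length u = N \<longrightarrow> \<kappa> (subst (Suc a) w u) = c))"
    using GR[unfolded GR_def, rule_format, of r N] by blast
  show ?case
  proof (intro exI[of _ "Suc n"] allI impI)
    fix \<kappa> :: "nat list \<Rightarrow> nat" assume \<kappa>: "\<forall>x. \<kappa> x < r"
    \<comment> \<open>This settles the empty prefix: \<open>a\<close> is the initial parameter, and
      counts as a letter in what follows.\<close>
    obtain v d where v: "v \<in> pwords (Suc a) N" "length v = n"
      "\<And>u. u \<in> pwords (Suc a) k \<Longrightarrow> length u = N \<Longrightarrow> \<kappa> (a # subst (Suc a) v u) = d"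
      using n[of "\<lambda>x. \<kappa> (a # x)"] \<kappa> by blast
    \<comment> \<open>Handles all initial letters \<open>c\<close> at once by taking a function of
      \<open>c\<close> as colour. Once the initial parameter is given the value \<open>c\<close>, so
      are its later occurrences: over \<open>a\<close> letters, the entry \<open>a\<close> of
      \<open>v\<close> is a parameter again, filled by the head of \<open>c # u\<close>.\<close>
    define \<xi> where "\<xi> u = (\<lambda>c\<in>{..<a}. \<kappa> (c # subst a v (c # u)))" for u
    have \<xi>: "\<xi> u \<in> ?C" for u using \<kappa> by (auto simp: \<xi>_def)
    obtain w where w: "w \<in> pwords a m" "length w = N"
      and wF: "\<And>p q q'. set p \<subseteq> {..<a} \<Longrightarrow> q \<in> pwords (Suc a) k \<Longrightarrow> q' \<in> pwords (Suc a) k \<Longrightarrow>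
        length (p @ a # q) = m \<Longrightarrow> length (p @ a # q') = m \<Longrightarrow>
        F (\<xi> (subst a w (p @ a # q))) = F (\<xi> (subst a w (p @ a # q')))"
      using N[of "\<lambda>x. F (\<xi> x)"] F(2)[OF \<xi>] by blast
    have w\<kappa>: "\<kappa> (c # subst a v (c # subst a w (p @ a # q))) = \<kappa> (c # subst a v (c # subst a w (p @ a # q')))"
      if "c < a" "set p \<subseteq> {..<a}" "q \<in> pwords (Suc a) k" "q' \<in> pwords (Suc a) k"
        "length (p @ a # q) = m" "length (p @ a # q') = m" for c p q q'
    proof -
      have "\<xi> (subst a w (p @ a # q)) = \<xi> (subst a w (p @ a # q'))"
        using wF[OF that(2-)] inj_onD[OF F(1)] \<xi> by blast
      from fun_cong[OF this, of c] show ?thesis using that(1) by (simp add: \<xi>_def)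
    qed
    \<comment> \<open>The initial \<open>a\<close> of the word \<open>z\<close> to be built is a new
      parameter number \<open>0\<close>, so the parameters of \<open>w\<close> move up by
      one.\<close>
    define sh where "sh c = (if c < a then c else Suc c)" for c
    define w' where "w' = map sh w"
    have len': "length w' = N" using w(2) by (simp add: w'_def)
    have w': "w' \<in> pwords (Suc a) m"
      unfolding pwords_def
    proof (intro CollectI conjI allI impI)
      show "set w' \<subseteq> {..<Suc a + m}" using set_pwords[OF w(1)] by (auto simp: w'_def sh_def)
    next
      fix j assume "j < m"
      then obtain xs ys where "w = xs @ (a + j) # ys" "set xs \<subseteq> {..<a + j}"
        using pwords_first[OF w(1)] by blast
      then show "\<exists>xs ys. w' = xs @ (Suc a + j) # ys \<and> set xs \<subseteq> {..<Suc a + j}"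
        by (intro exI[of _ "map sh xs"] exI[of _ "map sh ys"]) (auto simp: w'_def sh_def)
    qed
    define z where "z = a # subst (Suc a) v w'"
    have z: "z \<in> pwords a (Suc m)" "length z = Suc n"
      using subst_in_pwords[OF v(1) w' len'] v(2) by (auto simp: z_def intro: pwords_Cons)
    have nth_w': "w' ! i = sh (w ! i)" if "i < N" for i using that w(2) by (simp add: w'_def)
    have sv: "x < Suc (a + N)" if "x \<in> set v" for x using set_pwords[OF v(1)] that by auto
    have zc: "subst a z (c # u) = c # subst a v (c # subst a w u)" if "c < a" for c u
    proof -
      have "map ((\<lambda>x. if x < a then x else (c # u) ! (x - a)) \<circ>
            (\<lambda>x. if x < Suc a then x else w' ! (x - Suc a))) v =
          map (\<lambda>x. if x < a then x else (c # subst a w u) ! (x - a)) v"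
      proof (rule map_cong[OF refl])
        fix x assume "x \<in> set v"
        consider "x < a" | "x = a" | i where "x = Suc (a + i)" "i < N"
          using sv[OF \<open>x \<in> set v\<close>] by (cases x a rule: linorder_cases) (auto dest!: less_imp_Suc_add)
        then show "((\<lambda>x. if x < a then x else (c # u) ! (x - a)) \<circ>
            (\<lambda>x. if x < Suc a then x else w' ! (x - Suc a))) x =
            (if x < a then x else (c # subst a w u) ! (x - a))"
          by cases (auto simp: nth_w' w(2) sh_def subst_def Suc_diff_le)
      qed
      then show ?thesis using that by (simp add: z_def subst_def)
    qed
    have za: "subst a z (a # u) = a # subst (Suc a) v (subst (Suc a) w' u)" for u
    proof -
      have "map ((\<lambda>x. if x < a then x else (a # u) ! (x - a)) \<circ>
            (\<lambda>x. if x < Suc a then x else w' ! (x - Suc a))) v =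
          map (\<lambda>x. if x < Suc a then x else subst (Suc a) w' u ! (x - Suc a)) v"
      proof (rule map_cong[OF refl])
        fix x assume "x \<in> set v"
        consider "x < a" | "x = a" | i where "x = Suc (a + i)" "i < N"
          using sv[OF \<open>x \<in> set v\<close>] by (cases x a rule: linorder_cases) (auto dest!: less_imp_Suc_add)
        then show "((\<lambda>x. if x < a then x else (a # u) ! (x - a)) \<circ>
            (\<lambda>x. if x < Suc a then x else w' ! (x - Suc a))) x =
            (if x < Suc a then x else subst (Suc a) w' u ! (x - Suc a))"
          by cases (auto simp: nth_w' len' sh_def subst_def Suc_diff_le)
      qed
      then show ?thesis by (simp add: z_def subst_def)
    qed
    have "\<kappa> (subst a z (p @ a # q)) = \<kappa> (subst a z (p @ a # q'))"
      if p: "set p \<subseteq> {..<a}" and q: "q \<in> pwords (Suc a) k" "q' \<in> pwords (Suc a) k"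
        and len: "length (p @ a # q) = Suc m" "length (p @ a # q') = Suc m" for p q q'
    proof (cases p)
      case Nil
      have "\<kappa> (subst a z (a # u)) = d" if "u \<in> pwords (Suc a) k" "length u = m" for u
        using za v(3)[OF subst_in_pwords[OF w' that]] len' by simp
      then show ?thesis using Nil q len by simp
    next
      case (Cons c p')
      then show ?thesis using w\<kappa>[of c p' q q'] zc[of c] p q len by simp
    qed
    then show "\<exists>w \<in> pwords a (Suc m). length w = Suc n \<and>
      (\<forall>p q q'. set p \<subseteq> {..<a} \<longrightarrow> q \<in> pwords (Suc a) k \<longrightarrow> q' \<in> pwords (Suc a) k \<longrightarrow>
        length (p @ a # q) = Suc m \<longrightarrow> length (p @ a # q') = Suc m \<longrightarrow>
        \<kappa> (subst a w (p @ a # q)) = \<kappa> (subst a w (p @ a # q')))"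
      using z by blast
  qed
qed

text \<open>Without parameters this is \<open>Hales_Jewett_subspace\<close>. For
  \<open>Suc k\<close> parameters, \<open>GR_fusion\<close> turns the colouring of words into a
  colouring of prefixes, and \<open>prefix_colouring\<close>, with the same dimension
  \<open>m\<close> for every colour, makes the latter constant. The induction hypothesis is needed
  for a larger alphabet.\<close>

lemma Graham_Rothschild: "a \<ge> 1 \<Longrightarrow> GR a k"
proof (induction k arbitrary: a)
  case 0
  have "(\<forall>u \<in> pwords a 0. length u = m \<longrightarrow> Q u) \<longleftrightarrow> (\<forall>u \<in> words a m. Q u)" for Q m
    by (auto simp: words_def pwords_0)
  then show ?case using Hales_Jewett_subspace[OF 0] by (simp add: GR_def)
next
  case (Suc k a)
  show ?case unfolding GR_def
  proof (intro allI)
    fix r m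
    obtain M where M: "\<And>\<psi> :: nat list \<Rightarrow> nat. (\<forall>x. \<psi> x < r) \<Longrightarrow>
      (\<exists>c<r. \<exists>g \<in> pwords a m. length g \<le> M \<and>
      (\<forall>u. length u = m \<longrightarrow> (\<exists>x\<in>set u. a \<le> x) \<longrightarrow> \<psi> (prefix_word a (subst a g u)) = c))"
      using prefix_colouring[OF Suc.prems, where m = "\<lambda>_. m" and r = r, OF refl] by blast
    obtain n where n: "\<And>\<kappa> :: nat list \<Rightarrow> nat. (\<forall>x. \<kappa> x < r) \<Longrightarrow>
      (\<exists>w \<in> pwords a M. length w = n \<and>
      (\<forall>p q q'. set p \<subseteq> {..<a} \<longrightarrow> q \<in> pwords (Suc a) k \<longrightarrow> q' \<in> pwords (Suc a) k \<longrightarrow>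
        length (p @ a # q) = M \<longrightarrow> length (p @ a # q') = M \<longrightarrow>
        \<kappa> (subst a w (p @ a # q)) = \<kappa> (subst a w (p @ a # q'))))"
      using GR_fusion[OF Suc.IH[OF le_SucI[OF Suc.prems]], of r M] by blast
    show "\<exists>n. \<forall>\<kappa> :: nat list \<Rightarrow> nat. (\<forall>x. \<kappa> x < r) \<longrightarrow>
      (\<exists>w \<in> pwords a m. length w = n \<and>
      (\<exists>c. \<forall>u \<in> pwords a (Suc k). length u = m \<longrightarrow> \<kappa> (subst a w u) = c))"
    proof (intro exI[of _ n] allI impI)
      fix \<kappa> :: "nat list \<Rightarrow> nat" assume \<kappa>: "\<forall>x. \<kappa> x < r"
      obtain w where w: "w \<in> pwords a M" "length w = n" and
        w\<kappa>: "\<And>p q q'. set p \<subseteq> {..<a} \<Longrightarrow> q \<in> pwords (Suc a) k \<Longrightarrow> q' \<in> pwords (Suc a) k \<Longrightarrow>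
        length (p @ a # q) = M \<Longrightarrow> length (p @ a # q') = M \<Longrightarrow>
        \<kappa> (subst a w (p @ a # q)) = \<kappa> (subst a w (p @ a # q'))"
        using n[OF \<kappa>] by blast
      \<comment> \<open>The colour of a prefix is read off from an arbitrary completion; by the
        choice of \<open>w\<close> it does not depend on which one.\<close>
      define Q where "Q p = (SOME q. q \<in> pwords (Suc a) k \<and> length (p @ a # q) = M)" for p
      define \<psi> where "\<psi> p = \<kappa> (subst a w (p @ a # Q p))" for p
      obtain c g where g: "g \<in> pwords a m" "length g \<le> M"
        and gc: "\<And>u. length u = m \<Longrightarrow> \<exists>x\<in>set u. a \<le> x \<Longrightarrow> \<psi> (prefix_word a (subst a g u)) = c"
        using M[of \<psi>] \<kappa> unfolding \<psi>_def by blast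
      define f where "f = g @ replicate (M - length g) 0"
      have f: "f \<in> pwords a m" "length f = M"
        using pad_pwords[OF Suc.prems g] by (auto simp: f_def)
      have "\<kappa> (subst a (subst a w f) u) = c" if u: "u \<in> pwords a (Suc k)" "length u = m" for u
      proof -
        let ?x = "subst a f u"
        have nl: "\<exists>x\<in>set u. a \<le> x" using pwords_SucE[OF u(1)] by fastforce
        obtain p q where x: "?x = p @ a # q" and p: "set p \<subseteq> {..<a}" and q: "q \<in> pwords (Suc a) k"
          using subst_in_pwords[OF f(1) u] by (rule pwords_SucE)
        have len: "length (p @ a # q) = M" using f(2) x by (metis length_subst)
        have Qp: "Q p \<in> pwords (Suc a) k \<and> length (p @ a # Q p) = M"
          unfolding Q_def by (rule someI[of _ q]) (use q len in simp)
        have "prefix_word a ?x = prefix_word a (subst a g u)"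
          unfolding f_def using g(1) u nl by (intro prefix_word_pad) auto
        then have "\<psi> p = c" using gc[OF u(2) nl] x p by simp
        then have "\<kappa> (subst a w ?x) = c"
          unfolding x using w\<kappa>[OF p q conjunct1[OF Qp] len conjunct2[OF Qp]] by (simp add: \<psi>_def)
        moreover have "subst a (subst a w f) u = subst a w ?x"
          using set_pwords[OF w(1)] by (intro subst_assoc) (simp add: f(2))
        ultimately show ?thesis by simp
      qed
      then show "\<exists>w \<in> pwords a m. length w = n \<and>
          (\<exists>c. \<forall>u \<in> pwords a (Suc k). length u = m \<longrightarrow> \<kappa> (subst a w u) = c)"
        using subst_in_pwords[OF w(1) f] w(2) by (intro bexI[of _ "subst a w f"]) auto
    qed
  qed
qed

section \<open>The Ramsey property of ordered polyhedra\<close>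

definition rank_in :: "('b \<Rightarrow> 'b \<Rightarrow> bool) \<Rightarrow> 'b set \<Rightarrow> 'b \<Rightarrow> nat" where
  "rank_in R F x = card {y \<in> F. R y x}"

lemma rank_in:
  assumes F: "finite F" and irr: "\<And>x. x \<in> F \<Longrightarrow> \<not> R x x"
    and tr: "\<And>x y z. x \<in> F \<Longrightarrow> y \<in> F \<Longrightarrow> z \<in> F \<Longrightarrow> R x y \<Longrightarrow> R y z \<Longrightarrow> R x z"
    and tot: "\<And>x y. x \<in> F \<Longrightarrow> y \<in> F \<Longrightarrow> x \<noteq> y \<Longrightarrow> R x y \<or> R y x"
  shows rank_in_less_iff: "\<And>x y. x \<in> F \<Longrightarrow> y \<in> F \<Longrightarrow> rank_in R F x < rank_in R F y \<longleftrightarrow> R x y"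
    and bij_betw_rank_in: "bij_betw (rank_in R F) F {..<card F}"
proof -
  have mono: "rank_in R F x < rank_in R F y" if xy: "x \<in> F" "y \<in> F" "R x y" for x y
    unfolding rank_in_def
  proof (rule psubset_card_mono)
    show "finite {z \<in> F. R z y}" using F by simp
    show "{z \<in> F. R z x} \<subset> {z \<in> F. R z y}" using xy irr tr by blast
  qed
  show iff: "rank_in R F x < rank_in R F y \<longleftrightarrow> R x y" if xy: "x \<in> F" "y \<in> F" for x y
    using mono[OF xy] mono[OF xy(2,1)] tot[OF xy] irr xy by (metis less_asym less_irrefl)
  have inj: "inj_on (rank_in R F) F"
    using mono tot by (intro inj_onI) (metis less_irrefl)
  have "rank_in R F x < card F" if "x \<in> F" for x
    unfolding rank_in_def using F that irr by (intro psubset_card_mono) auto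
  then have "rank_in R F ` F \<subseteq> {..<card F}" by auto
  then have "rank_in R F ` F = {..<card F}"
    using F inj by (intro card_subset_eq) (auto simp: card_image)
  then show "bij_betw (rank_in R F) F {..<card F}" using inj by (simp add: bij_betw_def)
qed

text \<open>\<open>S\<close> and \<open>T\<close> may contain simplices that do not lie in
  \<open>A\<close> and \<open>B\<close>. Thus the subpolyhedra induced on subsets of one big
  polyhedron all use the same \<open>S\<close> and \<open>r\<close>.\<close>

definition poly_embedding ::
  "'a set \<Rightarrow> 'a set set \<Rightarrow> 'a rel \<Rightarrow> 'b set \<Rightarrow> 'b set set \<Rightarrow> 'b rel \<Rightarrow> ('a \<Rightarrow> 'b) \<Rightarrow> bool" where
  "poly_embedding A S r B T t f \<longleftrightarrow> f ` A \<subseteq> B \<and> inj_on f A \<and>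
     (\<forall>x\<in>A. \<forall>y\<in>A. (x, y) \<in> r \<longleftrightarrow> (f x, f y) \<in> t) \<and> (\<forall>s\<subseteq>A. s \<in> S \<longleftrightarrow> f ` s \<in> T)"

lemma poly_embeddingD:
  assumes "poly_embedding A S r B T t f"
  shows "\<And>x. x \<in> A \<Longrightarrow> f x \<in> B" "inj_on f A"
    "\<And>x y. x \<in> A \<Longrightarrow> y \<in> A \<Longrightarrow> (f x, f y) \<in> t \<longleftrightarrow> (x, y) \<in> r"
    "\<And>s. s \<subseteq> A \<Longrightarrow> f ` s \<in> T \<longleftrightarrow> s \<in> S"
  using assms by (auto simp: poly_embedding_def)

lemma poly_embeddingI:
  assumes "\<And>x. x \<in> A \<Longrightarrow> f x \<in> B" "inj_on f A"
    "\<And>x y. x \<in> A \<Longrightarrow> y \<in> A \<Longrightarrow> (f x, f y) \<in> t \<longleftrightarrow> (x, y) \<in> r"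
    "\<And>s. s \<subseteq> A \<Longrightarrow> f ` s \<in> T \<longleftrightarrow> s \<in> S"
  shows "poly_embedding A S r B T t f"
  unfolding poly_embedding_def using assms by blast

lemma poly_embedding_comp:
  assumes f: "poly_embedding A S r B T t f" and g: "poly_embedding B T t C V v g"
  shows "poly_embedding A S r C V v (g \<circ> f)"
proof (rule poly_embeddingI)
  note f = poly_embeddingD[OF f] and g = poly_embeddingD[OF g]
  have fA: "f ` A \<subseteq> B" using f(1) by blast
  show "(g \<circ> f) x \<in> C" if "x \<in> A" for x using f(1) g(1) that by simp
  show "inj_on (g \<circ> f) A" using f(2) inj_on_subset[OF g(2) fA] by (rule comp_inj_on)
  show "((g \<circ> f) x, (g \<circ> f) y) \<in> v \<longleftrightarrow> (x, y) \<in> r" if "x \<in> A" "y \<in> A" for x y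
    using f(1,3) g(3) that by simp
  show "(g \<circ> f) ` s \<in> V \<longleftrightarrow> s \<in> S" if "s \<subseteq> A" for s
  proof -
    have "f ` s \<subseteq> B" using that fA by blast
    moreover have "(g \<circ> f) ` s = g ` (f ` s)" by (simp only: image_comp)
    ultimately show ?thesis using f(4)[OF that] g(4) by metis
  qed
qed

text \<open>The cube is the nerve of the family of all nonempty subsets of \<open>{..<N}\<close>.\<close>

definition cube_vertices :: "nat \<Rightarrow> nat set set" where
  "cube_vertices N = Pow {..<N} - {{}}"

definition cube_simplices :: "nat \<Rightarrow> nat set set set" where
  "cube_simplices N = {F. F \<subseteq> cube_vertices N \<and> (F = {} \<or> (\<exists>i. \<forall>X\<in>F. i \<in> X))}"

text \<open>The lexicographic order of indicator sequences, with membership counted as smaller: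
  under a nerve map the smaller of two vertices is the one met first.\<close>

definition cube_less :: "nat \<Rightarrow> nat set rel" where
  "cube_less N = {(X, Y). X \<in> cube_vertices N \<and> Y \<in> cube_vertices N \<and>
     (\<exists>i. i \<in> X \<and> i \<notin> Y \<and> (\<forall>j<i. j \<in> X \<longleftrightarrow> j \<in> Y))}"

lemma finite_cube_vertices [simp]: "finite (cube_vertices N)"
  by (simp add: cube_vertices_def)

lemma cube_ordered_polyhedron:
  "ordered_polyhedron (cube_vertices N) (cube_simplices N) (cube_less N)"
proof -
  have sub: "F \<subseteq> cube_vertices N" if "F \<in> cube_simplices N" for F
    using that by (simp add: cube_simplices_def)
  have fin: "finite F" if "F \<in> cube_simplices N" for F
    using sub[OF that] finite_cube_vertices by (rule finite_subset)
  have her: "G \<in> cube_simplices N" if "F \<in> cube_simplices N" "G \<subseteq> F" for F G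
    using that unfolding cube_simplices_def by blast
  have "{X} \<in> cube_simplices N" if "X \<in> cube_vertices N" for X
    using that by (auto simp: cube_simplices_def cube_vertices_def)
  then have "\<Union> (cube_simplices N) = cube_vertices N" using sub by blast
  then have "hereditary_polyhedron (cube_vertices N) (cube_simplices N)"
    unfolding hereditary_polyhedron_def using fin her countable_finite[OF finite_cube_vertices] by blast
  moreover have "trans (cube_less N)"
  proof (rule transI)
    fix X Y Z assume XY: "(X, Y) \<in> cube_less N" and YZ: "(Y, Z) \<in> cube_less N"
    obtain i where i: "i \<in> X" "i \<notin> Y" "\<forall>k<i. k \<in> X \<longleftrightarrow> k \<in> Y" using XY by (auto simp: cube_less_def)
    obtain j where j: "j \<in> Y" "j \<notin> Z" "\<forall>k<j. k \<in> Y \<longleftrightarrow> k \<in> Z" using YZ by (auto simp: cube_less_def)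
    have "min i j \<in> X \<and> min i j \<notin> Z \<and> (\<forall>k<min i j. k \<in> X \<longleftrightarrow> k \<in> Z)"
      using i j by (cases i j rule: linorder_cases) auto
    then show "(X, Z) \<in> cube_less N" using XY YZ unfolding cube_less_def by blast
  qed
  moreover have "irrefl (cube_less N)" by (auto simp: irrefl_def cube_less_def)
  moreover have "total_on (cube_vertices N) (cube_less N)"
  proof (rule total_onI)
    fix X Y assume XY: "X \<in> cube_vertices N" "Y \<in> cube_vertices N" "X \<noteq> Y"
    then have ex: "\<exists>i. (i \<in> X) \<noteq> (i \<in> Y)" by blast
    define i where "i = (LEAST i. (i \<in> X) \<noteq> (i \<in> Y))"
    have "(i \<in> X) \<noteq> (i \<in> Y)" unfolding i_def using ex by (rule LeastI_ex)
    moreover have "\<forall>j<i. j \<in> X \<longleftrightarrow> j \<in> Y" unfolding i_def using not_less_Least by blast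
    ultimately show "(X, Y) \<in> cube_less N \<or> (Y, X) \<in> cube_less N"
      using XY by (auto simp: cube_less_def)
  qed
  moreover have "cube_less N \<subseteq> cube_vertices N \<times> cube_vertices N" by (auto simp: cube_less_def)
  ultimately show ?thesis by (simp add: ordered_polyhedron_def strict_linear_order_on_def)
qed

text \<open>The colexicographic order extends inclusion and is preserved by embeddings.\<close>

definition colex :: "'a rel \<Rightarrow> 'a set \<Rightarrow> 'a set \<Rightarrow> bool" where
  "colex r \<sigma> \<tau> \<longleftrightarrow> (\<exists>x \<in> \<tau> - \<sigma>. \<forall>y. (x, y) \<in> r \<longrightarrow> (y \<in> \<sigma> \<longleftrightarrow> y \<in> \<tau>))"

definition faces :: "'a set set \<Rightarrow> 'a set \<Rightarrow> 'a set set" where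
  "faces S A = S \<inter> Pow A"

definition face_rank :: "'a set set \<Rightarrow> 'a rel \<Rightarrow> 'a set \<Rightarrow> 'a set \<Rightarrow> nat" where
  "face_rank S r A = rank_in (colex r) (faces S A)"

definition nth_face :: "'a set set \<Rightarrow> 'a rel \<Rightarrow> 'a set \<Rightarrow> nat \<Rightarrow> 'a set" where
  "nth_face S r A = inv_into (faces S A) (face_rank S r A)"

text \<open>The empty face has number \<open>0\<close>, so the nonempty faces play the role of the parameters in words
  over the alphabet \<open>{0}\<close>.\<close>

definition nerve_map :: "'a set set \<Rightarrow> 'a rel \<Rightarrow> 'a set \<Rightarrow> nat list \<Rightarrow> 'a \<Rightarrow> nat set" where
  "nerve_map S r A u v = {i. i < length u \<and> v \<in> nth_face S r A (u ! i)}"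

definition trace_word :: "'a set set \<Rightarrow> 'a rel \<Rightarrow> 'a set \<Rightarrow> 'a set \<Rightarrow> ('a \<Rightarrow> 'a) \<Rightarrow> nat list" where
  "trace_word S r A B j =
     map (\<lambda>t. face_rank S r A {v \<in> A. j v \<in> nth_face S r B (Suc t)}) [0..<card (faces S B) - 1]"

text \<open>That the simplices cover \<open>U\<close> forces \<open>{} \<in> S\<close> only for
  nonempty \<open>U\<close>; assuming it separately lets the empty face always have number
  \<open>0\<close>.\<close>

locale ordered_poly =
  fixes U :: "'a set" and S :: "'a set set" and r :: "'a rel"
  assumes ordered_polyhedron: "ordered_polyhedron U S r"
    and empty_simplex: "{} \<in> S"
begin

lemma trans_r: "(x, y) \<in> r \<Longrightarrow> (y, z) \<in> r \<Longrightarrow> (x, z) \<in> r"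
  using ordered_polyhedron by (auto simp: ordered_polyhedron_def strict_linear_order_on_def dest: transD)

lemma irrefl_r: "(x, x) \<notin> r"
  using ordered_polyhedron by (auto simp: ordered_polyhedron_def strict_linear_order_on_def irrefl_def)

lemma total_r: "x \<in> U \<Longrightarrow> y \<in> U \<Longrightarrow> x \<noteq> y \<Longrightarrow> (x, y) \<in> r \<or> (y, x) \<in> r"
  using ordered_polyhedron by (auto simp: ordered_polyhedron_def strict_linear_order_on_def total_on_def)

lemma hereditary: "v \<in> S \<Longrightarrow> u \<subseteq> v \<Longrightarrow> u \<in> S"
  using ordered_polyhedron by (auto simp: ordered_polyhedron_def hereditary_polyhedron_def)

lemma singleton_simplex: "x \<in> U \<Longrightarrow> {x} \<in> S"
proof -
  assume "x \<in> U"
  then obtain s where "s \<in> S" "x \<in> s"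
    using ordered_polyhedron by (auto simp: ordered_polyhedron_def hereditary_polyhedron_def)
  then show ?thesis using hereditary[of s "{x}"] by simp
qed

lemma ex_greatest:
  assumes "finite D" "D \<noteq> {}" "D \<subseteq> U"
  shows "\<exists>x\<in>D. \<forall>y\<in>D. (x, y) \<notin> r"
  using assms
proof (induction D rule: finite_ne_induct)
  case (singleton x)
  then show ?case using irrefl_r by simp
next
  case (insert x D)
  then obtain m where m: "m \<in> D" "\<forall>y\<in>D. (m, y) \<notin> r" by auto
  show ?case
  proof (cases "(m, x) \<in> r")
    case True
    then have "\<forall>y\<in>insert x D. (x, y) \<notin> r" using m irrefl_r trans_r by blast
    then show ?thesis by blast
  next
    case False
    then show ?thesis using m by blast
  qed
qed

text \<open>The larger of the two witnesses is a witness for the composition.\<close>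

lemma colex_trans:
  assumes "\<tau> \<subseteq> U" "\<rho> \<subseteq> U" "colex r \<sigma> \<tau>" "colex r \<tau> \<rho>"
  shows "colex r \<sigma> \<rho>"
proof -
  obtain x where x: "x \<in> \<tau>" "x \<notin> \<sigma>" "\<And>y. (x, y) \<in> r \<Longrightarrow> y \<in> \<sigma> \<longleftrightarrow> y \<in> \<tau>"
    using assms(3) by (auto simp: colex_def)
  obtain z where z: "z \<in> \<rho>" "z \<notin> \<tau>" "\<And>y. (z, y) \<in> r \<Longrightarrow> y \<in> \<tau> \<longleftrightarrow> y \<in> \<rho>"
    using assms(4) by (auto simp: colex_def)
  have "(x, z) \<in> r \<or> (z, x) \<in> r" using x z assms by (intro total_r) auto
  then show ?thesis
  proof
    assume xz: "(x, z) \<in> r"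
    then have "z \<notin> \<sigma>" "\<And>y. (z, y) \<in> r \<Longrightarrow> y \<in> \<sigma> \<longleftrightarrow> y \<in> \<rho>" using x z trans_r by blast+
    then show ?thesis using z(1) by (auto simp: colex_def)
  next
    assume zx: "(z, x) \<in> r"
    then have "x \<in> \<rho>" "\<And>y. (x, y) \<in> r \<Longrightarrow> y \<in> \<sigma> \<longleftrightarrow> y \<in> \<rho>" using x z trans_r by blast+
    then show ?thesis using x(2) by (auto simp: colex_def)
  qed
qed

text \<open>The greatest element of the symmetric difference decides.\<close>

lemma colex_total:
  assumes "finite \<sigma>" "finite \<tau>" "\<sigma> \<subseteq> U" "\<tau> \<subseteq> U" "\<sigma> \<noteq> \<tau>"
  shows "colex r \<sigma> \<tau> \<or> colex r \<tau> \<sigma>"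
proof -
  let ?D = "(\<sigma> - \<tau>) \<union> (\<tau> - \<sigma>)"
  have "?D \<noteq> {}" using assms(5) by blast
  then obtain x where "x \<in> ?D" "\<forall>y\<in>?D. (x, y) \<notin> r"
    using ex_greatest[of ?D] assms by auto
  then show ?thesis unfolding colex_def by blast
qed

lemma colex_irrefl: "\<not> colex r \<sigma> \<sigma>"
  by (simp add: colex_def)

lemma colex_subset:
  assumes "finite \<tau>" "\<tau> \<subseteq> U" "\<sigma> \<subset> \<tau>"
  shows "colex r \<sigma> \<tau>"
  using colex_total[of \<sigma> \<tau>] assms finite_subset[of \<sigma> \<tau>] by (auto simp: colex_def)

lemma colex_image:
  assumes j: "poly_embedding A S r B S r j" and A: "A \<subseteq> U" "\<sigma> \<subseteq> A" "\<tau> \<subseteq> A" and "colex r \<sigma> \<tau>"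
  shows "colex r (j ` \<sigma>) (j ` \<tau>)"
proof -
  obtain x where x: "x \<in> \<tau>" "x \<notin> \<sigma>" "\<And>y. (x, y) \<in> r \<Longrightarrow> y \<in> \<sigma> \<longleftrightarrow> y \<in> \<tau>"
    using assms(5) by (auto simp: colex_def)
  have "j x \<notin> j ` \<sigma>" using x A poly_embeddingD(2)[OF j] by (auto dest: inj_onD)
  moreover have "y \<in> j ` \<sigma> \<longleftrightarrow> y \<in> j ` \<tau>" if "(j x, y) \<in> r" for y
    using that poly_embeddingD(3)[OF j] x A by (auto simp: image_iff) (metis subsetD)+
  ultimately show ?thesis using x(1) unfolding colex_def by blast
qed

context
  fixes A assumes A: "finite A" "A \<subseteq> U"
begin

lemma finite_faces: "finite (faces S A)"
  using A by (simp add: faces_def)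

lemma colex_faces_trans:
  "\<sigma> \<in> faces S A \<Longrightarrow> \<tau> \<in> faces S A \<Longrightarrow> \<rho> \<in> faces S A \<Longrightarrow> colex r \<sigma> \<tau> \<Longrightarrow> colex r \<tau> \<rho> \<Longrightarrow> colex r \<sigma> \<rho>"
  using A by (intro colex_trans[of \<tau> \<rho> \<sigma>]) (auto simp: faces_def)

lemma colex_faces_total:
  "\<sigma> \<in> faces S A \<Longrightarrow> \<tau> \<in> faces S A \<Longrightarrow> \<sigma> \<noteq> \<tau> \<Longrightarrow> colex r \<sigma> \<tau> \<or> colex r \<tau> \<sigma>"
  using A by (intro colex_total) (auto simp: faces_def intro: finite_subset)

lemma face_rank_less_iff:
  "\<sigma> \<in> faces S A \<Longrightarrow> \<tau> \<in> faces S A \<Longrightarrow> face_rank S r A \<sigma> < face_rank S r A \<tau> \<longleftrightarrow> colex r \<sigma> \<tau>"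
  unfolding face_rank_def
  by (rule rank_in_less_iff[OF finite_faces])
    (simp add: colex_irrefl | erule (4) colex_faces_trans | erule (2) colex_faces_total | assumption)+

lemma bij_face_rank: "bij_betw (face_rank S r A) (faces S A) {..<card (faces S A)}"
  unfolding face_rank_def
  by (rule bij_betw_rank_in[OF finite_faces])
    (simp add: colex_irrefl | erule (4) colex_faces_trans | erule (2) colex_faces_total)+

lemma nth_face: "i < card (faces S A) \<Longrightarrow> nth_face S r A i \<in> faces S A"
  unfolding nth_face_def using bij_face_rank by (metis bij_betw_def inv_into_into lessThan_iff)

lemma face_rank_nth_face: "i < card (faces S A) \<Longrightarrow> face_rank S r A (nth_face S r A i) = i"
  unfolding nth_face_def using bij_face_rank by (metis bij_betw_inv_into_right lessThan_iff)

lemma nth_face_rank: "\<sigma> \<in> faces S A \<Longrightarrow> nth_face S r A (face_rank S r A \<sigma>) = \<sigma>"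
  unfolding nth_face_def using bij_face_rank by (metis bij_betw_inv_into_left)

lemma face_rank_less: "\<sigma> \<in> faces S A \<Longrightarrow> face_rank S r A \<sigma> < card (faces S A)"
  using bij_face_rank by (metis bij_betwE lessThan_iff)

lemma face_rank_empty: "face_rank S r A {} = 0"
  by (simp add: face_rank_def rank_in_def colex_def)

lemma empty_face: "{} \<in> faces S A"
  using empty_simplex by (simp add: faces_def)

lemma card_faces_pos: "card (faces S A) > 0"
  using empty_face finite_faces by (auto simp: card_gt_0_iff)

lemma face_rank_mono:
  assumes "\<sigma> \<in> faces S A" "\<tau> \<in> faces S A" "\<sigma> \<subseteq> \<tau>"
  shows "face_rank S r A \<sigma> \<le> face_rank S r A \<tau>"
proof (cases "\<sigma> = \<tau>")
  case False
  then have "colex r \<sigma> \<tau>"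
    using assms A by (intro colex_subset) (auto simp: faces_def intro: finite_subset)
  then show ?thesis using face_rank_less_iff[OF assms(1,2)] by simp
qed simp

lemma face_rank_pos:
  assumes "\<sigma> \<in> faces S A" "\<sigma> \<noteq> {}"
  shows "face_rank S r A \<sigma> > 0"
  using assms nth_face_rank[OF assms(1)] nth_face_rank[OF empty_face] face_rank_empty
  by (metis gr0I)

text \<open>With the one-letter alphabet, parameter number \<open>j\<close> is the entry
  \<open>j + 1\<close> and stands for the face of rank \<open>j + 1\<close>. So every nonempty face
  occurs, preceded by faces of smaller rank only.\<close>

lemma pword_face_first:
  assumes u: "u \<in> pwords 1 (card (faces S A) - 1)" and \<sigma>: "\<sigma> \<in> faces S A" "\<sigma> \<noteq> {}"
  obtains i where "i < length u" "u ! i = face_rank S r A \<sigma>"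
    "\<And>k. k < i \<Longrightarrow> u ! k < face_rank S r A \<sigma>"
proof -
  let ?j = "face_rank S r A \<sigma> - 1"
  have pos: "face_rank S r A \<sigma> > 0" using face_rank_pos[OF \<sigma>] .
  then have "?j < card (faces S A) - 1" using face_rank_less[OF \<sigma>(1)] by simp
  then obtain xs ys where xs: "u = xs @ (1 + ?j) # ys" "set xs \<subseteq> {..<1 + ?j}"
    using pwords_first[OF u] by blast
  show ?thesis
  proof (rule that[of "length xs"])
    show "u ! k < face_rank S r A \<sigma>" if "k < length xs" for k
      using subsetD[OF xs(2) nth_mem[OF that]] xs(1) that pos by (simp add: nth_append)
  qed (use xs pos in auto)
qed

lemma pword_face_rank:
  assumes "u \<in> pwords 1 (card (faces S A) - 1)" "i < length u"
  shows "u ! i < card (faces S A)"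
  using subsetD[OF set_pwords[OF assms(1)] nth_mem[OF assms(2)]] card_faces_pos by simp

text \<open>The coordinate \<open>i\<close> belongs to the images of all vertices of
  \<open>s\<close> iff \<open>s\<close> lies in the face numbered \<open>u ! i\<close>. As all
  nonempty faces are listed, a nonempty \<open>s\<close> has a common coordinate iff it is a
  simplex. The order is decided by the first coordinate carrying the singleton of the smaller
  vertex.\<close>

lemma nerve_embedding:
  assumes u: "u \<in> pwords 1 (card (faces S A) - 1)"
  shows "poly_embedding A S r (cube_vertices (length u)) (cube_simplices (length u))
    (cube_less (length u)) (nerve_map S r A u)"
proof -
  let ?n = "length u" and ?f = "nerve_map S r A u"
  have single: "{v} \<in> faces S A" if "v \<in> A" for v
    using that A singleton_simplex by (auto simp: faces_def)
  have vert: "?f v \<in> cube_vertices ?n" if v: "v \<in> A" for v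
  proof -
    obtain i where i: "i < ?n" "u ! i = face_rank S r A {v}"
      using pword_face_first[OF u single[OF v]] by blast
    then have "i \<in> ?f v" using nth_face_rank[OF single[OF v]] by (simp add: nerve_map_def)
    moreover have "?f v \<subseteq> {..<?n}" by (auto simp: nerve_map_def)
    ultimately show ?thesis by (auto simp: cube_vertices_def)
  qed
  have less: "(?f v, ?f w) \<in> cube_less ?n" if v: "v \<in> A" and w: "w \<in> A" and vw: "(v, w) \<in> r" for v w
  proof -
    obtain i where i: "i < ?n" "u ! i = face_rank S r A {v}"
      "\<And>k. k < i \<Longrightarrow> u ! k < face_rank S r A {v}"
      using pword_face_first[OF u single[OF v]] by blast
    have "v \<noteq> w" using vw irrefl_r by blast
    then have iv: "i \<in> ?f v" "i \<notin> ?f w"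
      using i(1,2) nth_face_rank[OF single[OF v]] by (auto simp: nerve_map_def)
    \<comment> \<open>A face colexicographically below \<open>{v}\<close> contains neither
      \<open>v\<close> nor anything above \<open>v\<close>, in particular not
      \<open>w\<close>.\<close>
    have "k \<notin> ?f v \<and> k \<notin> ?f w" if "k < i" for k
    proof -
      have k: "u ! k < card (faces S A)"
        using that i(1) by (intro pword_face_rank[OF u]) simp
      have "face_rank S r A (nth_face S r A (u ! k)) < face_rank S r A {v}"
        using face_rank_nth_face[OF k] i(3)[OF that] by simp
      then have "colex r (nth_face S r A (u ! k)) {v}"
        using face_rank_less_iff[OF nth_face[OF k] single[OF v]] by simp
      then show ?thesis using vw \<open>v \<noteq> w\<close> by (auto simp: nerve_map_def colex_def)
    qed
    then show ?thesis using iv vert[OF v] vert[OF w] unfolding cube_less_def by blast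
  qed
  have cube: "strict_linear_order_on (cube_vertices ?n) (cube_less ?n)"
    using cube_ordered_polyhedron by (auto simp: ordered_polyhedron_def)
  have irr: "(X, X) \<notin> cube_less ?n" for X
    using cube by (auto simp: strict_linear_order_on_def irrefl_def)
  have asym: "(Y, X) \<notin> cube_less ?n" if "(X, Y) \<in> cube_less ?n" for X Y
    using cube irr that unfolding strict_linear_order_on_def by (meson transD)
  show ?thesis
  proof (rule poly_embeddingI)
    show "?f v \<in> cube_vertices ?n" if "v \<in> A" for v using vert that .
    show "inj_on ?f A"
    proof (rule inj_onI, rule ccontr)
      fix v w assume vw: "v \<in> A" "w \<in> A" "?f v = ?f w" "v \<noteq> w"
      then have "(v, w) \<in> r \<or> (w, v) \<in> r" using A by (intro total_r) auto
      then show False using less vw irr by metis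
    qed
    show "(?f v, ?f w) \<in> cube_less ?n \<longleftrightarrow> (v, w) \<in> r" if vw: "v \<in> A" "w \<in> A" for v w
    proof
      assume l: "(?f v, ?f w) \<in> cube_less ?n"
      then have "v \<noteq> w" using irr by auto
      then have "(v, w) \<in> r \<or> (w, v) \<in> r" using A vw by (intro total_r) auto
      then show "(v, w) \<in> r" using less[OF vw(2,1)] asym l by blast
    qed (rule less[OF vw])
    show "?f ` s \<in> cube_simplices ?n \<longleftrightarrow> s \<in> S" if s: "s \<subseteq> A" for s
    proof
      assume im: "?f ` s \<in> cube_simplices ?n"
      show "s \<in> S"
      proof (cases "s = {}")
        case False
        then obtain i where i: "\<And>v. v \<in> s \<Longrightarrow> i \<in> ?f v" using im by (auto simp: cube_simplices_def)
        then have "i < ?n" using False by (auto simp: nerve_map_def)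
        then have "nth_face S r A (u ! i) \<in> faces S A" by (intro nth_face pword_face_rank[OF u])
        moreover have "s \<subseteq> nth_face S r A (u ! i)" using i by (auto simp: nerve_map_def)
        ultimately show ?thesis using hereditary by (auto simp: faces_def)
      qed (simp add: empty_simplex)
    next
      assume "s \<in> S"
      then have sf: "s \<in> faces S A" using s by (simp add: faces_def)
      have sub: "?f ` s \<subseteq> cube_vertices ?n" using vert s by blast
      show "?f ` s \<in> cube_simplices ?n"
      proof (cases "s = {}")
        case False
        then obtain i where "i < ?n" "u ! i = face_rank S r A s"
          using pword_face_first[OF u sf] by blast
        then have "\<forall>X\<in>?f ` s. i \<in> X" using nth_face_rank[OF sf] by (simp add: nerve_map_def)
        then show ?thesis using sub unfolding cube_simplices_def by blast
      qed (simp add: cube_simplices_def)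
    qed
  qed
qed

end

section \<open>Traces of faces along an embedding\<close>

context
  fixes A B j
  assumes A: "finite A" "A \<subseteq> U" and B: "finite B" "B \<subseteq> U"
    and j: "poly_embedding A S r B S r j"
begin

lemma trace_face: "\<tau> \<in> faces S B \<Longrightarrow> {v \<in> A. j v \<in> \<tau>} \<in> faces S A"
proof -
  assume \<tau>: "\<tau> \<in> faces S B"
  have "j ` {v \<in> A. j v \<in> \<tau>} \<in> S" by (rule hereditary[of \<tau>]) (use \<tau> in \<open>auto simp: faces_def\<close>)
  then have "{v \<in> A. j v \<in> \<tau>} \<in> S" using poly_embeddingD(4)[OF j, of "{v \<in> A. j v \<in> \<tau>}"] by auto
  then show ?thesis by (auto simp: faces_def)
qed

lemma image_face: "\<sigma> \<in> faces S A \<Longrightarrow> j ` \<sigma> \<in> faces S B"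
  using poly_embeddingD(1,4)[OF j] by (auto simp: faces_def)

lemma face_rank_image_mono:
  assumes "\<sigma> \<in> faces S A" "\<rho> \<in> faces S A" "face_rank S r A \<sigma> \<le> face_rank S r A \<rho>"
  shows "face_rank S r B (j ` \<sigma>) \<le> face_rank S r B (j ` \<rho>)"
proof (cases "\<sigma> = \<rho>")
  case False
  then have "\<not> colex r \<rho> \<sigma>" using face_rank_less_iff[OF A assms(2,1)] assms(3) by simp
  then have "colex r \<sigma> \<rho>" using colex_faces_total[OF A assms(1,2)] False by simp
  then have "colex r (j ` \<sigma>) (j ` \<rho>)"
    using assms A by (intro colex_image[OF j]) (auto simp: faces_def)
  then show ?thesis
    using face_rank_less_iff[OF B image_face image_face] assms(1,2) by (simp add: less_imp_le)
qed simp

lemma trace_word_in_pwords: "trace_word S r A B j \<in> pwords 1 (card (faces S A) - 1)"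
proof -
  let ?f = "\<lambda>t. face_rank S r A {v \<in> A. j v \<in> nth_face S r B (Suc t)}"
  let ?K = "card (faces S B) - 1"
  have face: "nth_face S r B (Suc t) \<in> faces S B" if "t < ?K" for t
    using that by (intro nth_face[OF B]) simp
  have "?f t < 1 + (card (faces S A) - 1)" if "t < ?K" for t
    using face_rank_less[OF A trace_face[OF face[OF that]]] by simp
  then have "set (trace_word S r A B j) \<subseteq> {..<1 + (card (faces S A) - 1)}"
    by (auto simp: trace_word_def)
  moreover have "\<exists>xs ys. trace_word S r A B j = xs @ (1 + m) # ys \<and> set xs \<subseteq> {..<1 + m}"
    if m: "m < card (faces S A) - 1" for m
  proof -
    define \<sigma> where "\<sigma> = nth_face S r A (Suc m)"
    have \<sigma>: "\<sigma> \<in> faces S A" "face_rank S r A \<sigma> = Suc m"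
      using nth_face[OF A, of "Suc m"] face_rank_nth_face[OF A, of "Suc m"] m by (auto simp: \<sigma>_def)
    then have "\<sigma> \<noteq> {}" using face_rank_empty[OF A] by auto
    then obtain t where t: "face_rank S r B (j ` \<sigma>) = Suc t"
      using face_rank_pos[OF B image_face[OF \<sigma>(1)]] by (auto simp: gr0_conv_Suc)
    then have tK: "t < ?K" using face_rank_less[OF B image_face[OF \<sigma>(1)]] by simp
    have "{v \<in> A. j v \<in> j ` \<sigma>} = \<sigma>"
      using \<sigma>(1) poly_embeddingD(2)[OF j] by (auto simp: faces_def dest: inj_onD)
    then have ft: "?f t = 1 + m"
      using nth_face_rank[OF B image_face[OF \<sigma>(1)]] t \<sigma>(2) by simp
    \<comment> \<open>If the trace \<open>\<rho>\<close> of an earlier face \<open>\<tau>\<close>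
      had at least the rank of \<open>\<sigma>\<close>, then \<open>j \<rho>\<close> would have at
      least the rank of \<open>j \<sigma>\<close>, embeddings being monotone on faces. But
      \<open>j \<rho> \<subseteq> \<tau>\<close>, so \<open>\<tau>\<close> would not come before
      \<open>j \<sigma>\<close>.\<close>
    have before: "?f k < 1 + m" if k: "k < t" for k
    proof (rule ccontr)
      let ?\<tau> = "nth_face S r B (Suc k)"
      let ?\<rho> = "{v \<in> A. j v \<in> ?\<tau>}"
      have kK: "k < ?K" using k tK by simp
      assume "\<not> ?f k < 1 + m"
      then have "face_rank S r A \<sigma> \<le> face_rank S r A ?\<rho>" using \<sigma>(2) by simp
      then have "Suc t \<le> face_rank S r B (j ` ?\<rho>)"
        using face_rank_image_mono[OF \<sigma>(1) trace_face[OF face[OF kK]]] t by simp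
      also have "\<dots> \<le> face_rank S r B ?\<tau>"
        using face[OF kK] by (intro face_rank_mono[OF B] image_face trace_face) auto
      also have "\<dots> = Suc k" using kK by (intro face_rank_nth_face[OF B]) simp
      finally show False using k by simp
    qed
    have "[0..<?K] = [0..<t] @ t # [Suc t..<?K]"
      using tK by (metis upt_add_eq_append upt_conv_Cons le_add_diff_inverse less_imp_le_nat zero_le)
    then have "trace_word S r A B j = map ?f [0..<t] @ (1 + m) # map ?f [Suc t..<?K]"
      using ft by (simp add: trace_word_def)
    moreover have "set (map ?f [0..<t]) \<subseteq> {..<1 + m}" using before by auto
    ultimately show ?thesis by blast
  qed
  ultimately show ?thesis unfolding pwords_def by blast
qed

text \<open>Composing a nerve embedding with \<open>j\<close> is substitution of a parameter word.
  This translates colourings of embeddings into colourings of words.\<close>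

lemma nerve_map_trace_word:
  assumes w: "w \<in> pwords 1 (card (faces S B) - 1)" and v: "v \<in> A"
  shows "nerve_map S r A (subst 1 w (trace_word S r A B j)) v = nerve_map S r B w (j v)"
proof -
  have "v \<in> nth_face S r A (subst 1 w (trace_word S r A B j) ! i) \<longleftrightarrow> j v \<in> nth_face S r B (w ! i)"
    if i: "i < length w" for i
  proof (cases "w ! i")
    case 0
    have "nth_face S r A 0 = {}" "nth_face S r B 0 = {}"
      using nth_face_rank[OF A empty_face[OF A]] face_rank_empty[OF A]
        nth_face_rank[OF B empty_face[OF B]] face_rank_empty[OF B] by auto
    then show ?thesis using 0 i by (simp add: subst_def)
  next
    case (Suc t)
    then have t: "Suc t < card (faces S B)" using pword_face_rank[OF B w i] by simp
    then have "subst 1 w (trace_word S r A B j) ! i =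
        face_rank S r A {v \<in> A. j v \<in> nth_face S r B (Suc t)}"
      using i Suc nth_upt[of 0 t "card (faces S B) - 1"] by (simp add: subst_def trace_word_def)
    then show ?thesis
      using nth_face_rank[OF A trace_face[OF nth_face[OF B t]]] v Suc by simp
  qed
  then show ?thesis by (auto simp: nerve_map_def)
qed

end

text \<open>A word is given the colour of its nerve map on \<open>A\<close>. Restricting to
  \<open>A\<close> makes maps that agree there equal, so that the translation into words is
  exact.\<close>

lemma polyhedra_Ramsey:
  assumes A: "finite A" "A \<subseteq> U" and B: "finite B" "B \<subseteq> U"
  shows "\<exists>N. \<forall>\<kappa> :: ('a \<Rightarrow> nat set) \<Rightarrow> nat. (\<forall>x. \<kappa> x < n) \<longrightarrow>
    (\<exists>E c. poly_embedding B S r (cube_vertices N) (cube_simplices N) (cube_less N) E \<and>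
      (\<forall>j. poly_embedding A S r B S r j \<longrightarrow> \<kappa> (restrict (E \<circ> j) A) = c))"
proof -
  let ?k = "card (faces S A) - 1" and ?m = "card (faces S B) - 1"
  obtain N where N: "\<And>\<kappa> :: nat list \<Rightarrow> nat. (\<forall>x. \<kappa> x < n) \<Longrightarrow>
    (\<exists>w \<in> pwords 1 ?m. length w = N \<and>
      (\<exists>c. \<forall>u \<in> pwords 1 ?k. length u = ?m \<longrightarrow> \<kappa> (subst 1 w u) = c))"
    using Graham_Rothschild[of 1 ?k, unfolded GR_def, rule_format, of n ?m] by auto
  show ?thesis
  proof (intro exI[of _ N] allI impI)
    fix \<kappa> :: "('a \<Rightarrow> nat set) \<Rightarrow> nat" assume \<kappa>: "\<forall>x. \<kappa> x < n"
    obtain w c where w: "w \<in> pwords 1 ?m" "length w = N"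
      and c: "\<And>u. u \<in> pwords 1 ?k \<Longrightarrow> length u = ?m \<Longrightarrow>
        \<kappa> (restrict (nerve_map S r A (subst 1 w u)) A) = c"
      using N[of "\<lambda>u. \<kappa> (restrict (nerve_map S r A u) A)"] \<kappa> by blast
    have "\<kappa> (restrict (nerve_map S r B w \<circ> j) A) = c" if j: "poly_embedding A S r B S r j" for j
    proof -
      have "restrict (nerve_map S r B w \<circ> j) A = restrict (nerve_map S r A (subst 1 w (trace_word S r A B j))) A"
        using nerve_map_trace_word[OF A B j w(1)] by (auto simp: restrict_def fun_eq_iff)
      then show ?thesis
        using c[OF trace_word_in_pwords[OF A B j]] by (simp add: trace_word_def)
    qed
    then show "\<exists>E c. poly_embedding B S r (cube_vertices N) (cube_simplices N) (cube_less N) E \<and>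
      (\<forall>j. poly_embedding A S r B S r j \<longrightarrow> \<kappa> (restrict (E \<circ> j) A) = c)"
      using nerve_embedding[OF B w(1)] w(2) by blast
  qed
qed

end

section \<open>The Fraisse limit\<close>

lemma map_prod_image_iff:
  assumes "inj_on g A" "r \<subseteq> A \<times> A" "x \<in> A" "y \<in> A"
  shows "(g x, g y) \<in> map_prod g g ` r \<longleftrightarrow> (x, y) \<in> r"
proof
  assume "(g x, g y) \<in> map_prod g g ` r"
  then obtain a b where ab: "(a, b) \<in> r" "g x = g a" "g y = g b" by auto
  then have "x = a" "y = b" using assms by (blast dest: inj_onD)+
  then show "(x, y) \<in> r" using ab(1) by simp
qed force

lemma in_polyhedron_rels_Less: "xs \<in> polyhedron_rels S r Less \<longleftrightarrow> (\<exists>x y. xs = [x, y] \<and> (x, y) \<in> r)"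
  by simp

lemma map_in_polyhedron_rels_Less:
  "map g xs \<in> polyhedron_rels S r Less \<longleftrightarrow> (\<exists>x y. xs = [x, y] \<and> (g x, g y) \<in> r)"
  by (auto simp: map_eq_Cons_conv)

lemma map_in_polyhedron_rels_image:
  assumes "inj_on g A" "S \<subseteq> Pow A" "r \<subseteq> A \<times> A" "xs \<in> lists A"
  shows "map g xs \<in> polyhedron_rels ((`) g ` S) (map_prod g g ` r) s \<longleftrightarrow> xs \<in> polyhedron_rels S r s"
proof (cases s)
  case (Simplex n)
  have "g ` set xs \<in> (`) g ` S \<longleftrightarrow> set xs \<in> S"
  proof
    assume "g ` set xs \<in> (`) g ` S"
    then obtain w where w: "w \<in> S" "g ` set xs = g ` w" by blast
    moreover have "set xs \<subseteq> A" "w \<subseteq> A" using w(1) assms(2,4) by auto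
    ultimately show "set xs \<in> S" using inj_on_image_eq_iff[OF assms(1)] by metis
  qed blast
  moreover have "distinct (map g xs) \<longleftrightarrow> distinct xs"
    using assms inj_on_subset[OF assms(1), of "set xs"] by (auto simp: distinct_map)
  ultimately show ?thesis using Simplex by simp
next
  case Less
  define t where "t = map_prod g g ` r"
  have "(g x, g y) \<in> t \<longleftrightarrow> (x, y) \<in> r" if "x \<in> A" "y \<in> A" for x y
    unfolding t_def by (rule map_prod_image_iff[OF assms(1,3) that])
  then have "map g xs \<in> polyhedron_rels ((`) g ` S) t s \<longleftrightarrow> xs \<in> polyhedron_rels S r s"
    using Less assms(4)
    by (auto simp: map_in_polyhedron_rels_Less in_polyhedron_rels_Less simp del: polyhedron_rels.simps)
  then show ?thesis by (simp add: t_def)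
qed

lemma ordered_polyhedronD:
  assumes "ordered_polyhedron A S r"
  shows "S \<subseteq> Pow A" "r \<subseteq> A \<times> A" "\<And>s. s \<in> S \<Longrightarrow> finite s"
  using assms by (auto simp: ordered_polyhedron_def hereditary_polyhedron_def)

lemma ordered_polyhedron_image:
  assumes P: "ordered_polyhedron A S r" and g: "inj_on g A"
  shows "ordered_polyhedron (g ` A) ((`) g ` S) (map_prod g g ` r)"
proof -
  note pair = map_prod_image_iff[OF g ordered_polyhedronD(2)[OF P]]
  have S: "S \<subseteq> Pow A" and r: "r \<subseteq> A \<times> A" and fin: "\<And>s. s \<in> S \<Longrightarrow> finite s"
    using ordered_polyhedronD[OF P] by auto
  have her: "\<And>v u. v \<in> S \<Longrightarrow> u \<subseteq> v \<Longrightarrow> u \<in> S" and "\<Union> S = A" and cA: "countable A"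
    using P by (auto simp: ordered_polyhedron_def hereditary_polyhedron_def)
  have tr: "trans r" and ir: "irrefl r" and tot: "total_on A r"
    using P by (auto simp: ordered_polyhedron_def strict_linear_order_on_def)
  have her': "u \<in> (`) g ` S" if "v \<in> (`) g ` S" "u \<subseteq> v" for u v
  proof -
    obtain w where "w \<in> S" "v = g ` w" using \<open>v \<in> (`) g ` S\<close> by blast
    then obtain z where "z \<subseteq> w" "u = g ` z" using \<open>u \<subseteq> v\<close> by (metis subset_image_iff)
    then show ?thesis using her \<open>w \<in> S\<close> by blast
  qed
  have Un': "\<Union> ((`) g ` S) = g ` A" using \<open>\<Union> S = A\<close> by blast
  have fin': "finite s" if "s \<in> (`) g ` S" for s using that fin by auto
  have "countable (g ` A)" using cA by simp
  then have "hereditary_polyhedron (g ` A) ((`) g ` S)"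
    unfolding hereditary_polyhedron_def
  proof (intro conjI ballI allI impI)
    show "u \<in> (`) g ` S" if "v \<in> (`) g ` S" "u \<subseteq> v" for u v using that by (rule her')
  qed (use Un' fin' in auto)
  moreover have "trans (map_prod g g ` r)"
  proof (rule transI)
    fix x y z assume "(x, y) \<in> map_prod g g ` r" "(y, z) \<in> map_prod g g ` r"
    then obtain a b b' c where *: "(a, b) \<in> r" "(b', c) \<in> r" "x = g a" "y = g b" "y = g b'" "z = g c"
      by auto
    moreover have "b \<in> A" "b' \<in> A" using *(1,2) r by auto
    ultimately have "b = b'" using g by (metis inj_onD)
    then have "(a, c) \<in> r" using * tr by (auto dest: transD)
    then show "(x, z) \<in> map_prod g g ` r" using * by auto
  qed
  moreover have "irrefl (map_prod g g ` r)"
  proof (rule irreflI, rule notI)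
    fix x assume "(x, x) \<in> map_prod g g ` r"
    then obtain a b where ab: "(a, b) \<in> r" "x = g a" "x = g b" by auto
    moreover have "a \<in> A" "b \<in> A" using ab(1) r by auto
    ultimately have "a = b" using g by (metis inj_onD)
    then show False using ab(1) ir by (simp add: irrefl_def)
  qed
  moreover have "total_on (g ` A) (map_prod g g ` r)"
  proof (rule total_onI)
    fix x y assume "x \<in> g ` A" "y \<in> g ` A" "x \<noteq> y"
    then obtain a b where "a \<in> A" "b \<in> A" "x = g a" "y = g b" "a \<noteq> b" by blast
    then show "(x, y) \<in> map_prod g g ` r \<or> (y, x) \<in> map_prod g g ` r"
      using tot pair by (auto simp: total_on_def)
  qed
  moreover have "map_prod g g ` r \<subseteq> g ` A \<times> g ` A" using r by auto
  ultimately show ?thesis by (simp add: ordered_polyhedron_def strict_linear_order_on_def)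
qed

text \<open>The relations speak only about nonempty simplices, all arities being positive; the empty
  one is covered by the hypotheses. A nonempty subset of \<open>A\<close> is tested by listing it
  without repetition, which uses its finiteness.\<close>

lemma poly_embedding_iff_rels:
  assumes "finite A" "{} \<in> S" "{} \<in> T"
  shows "poly_embedding A S r B T t f \<longleftrightarrow> f ` A \<subseteq> B \<and> inj_on f A \<and>
    (\<forall>s. \<forall>xs \<in> lists A. xs \<in> polyhedron_rels S r s \<longleftrightarrow> map f xs \<in> polyhedron_rels T t s)"
    (is "_ \<longleftrightarrow> _ \<and> _ \<and> ?rels")
proof
  assume f: "poly_embedding A S r B T t f"
  note f = poly_embeddingD[OF f]
  have "xs \<in> polyhedron_rels S r s \<longleftrightarrow> map f xs \<in> polyhedron_rels T t s" if xs: "xs \<in> lists A" for xs s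
  proof (cases s)
    case (Simplex n)
    have "distinct (map f xs) \<longleftrightarrow> distinct xs"
      using xs inj_on_subset[OF f(2), of "set xs"] by (auto simp: distinct_map)
    moreover have "f ` set xs \<in> T \<longleftrightarrow> set xs \<in> S" using xs by (intro f(4)) auto
    ultimately show ?thesis using Simplex by simp
  next
    case Less
    then show ?thesis using xs f(3) by (auto simp: map_eq_Cons_conv)
  qed
  then show "f ` A \<subseteq> B \<and> inj_on f A \<and> ?rels" using f(1,2) by blast
next
  assume *: "f ` A \<subseteq> B \<and> inj_on f A \<and> ?rels"
  then have rels: "\<And>s xs. xs \<in> lists A \<Longrightarrow> xs \<in> polyhedron_rels S r s \<longleftrightarrow> map f xs \<in> polyhedron_rels T t s"
    by blast
  show "poly_embedding A S r B T t f"
  proof (rule poly_embeddingI)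
    show "(f x, f y) \<in> t \<longleftrightarrow> (x, y) \<in> r" if "x \<in> A" "y \<in> A" for x y
      using rels[of "[x, y]" Less] that by simp
    show "f ` s \<in> T \<longleftrightarrow> s \<in> S" if s: "s \<subseteq> A" for s
    proof (cases "s = {}")
      case False
      have "finite s" using s assms(1) by (rule finite_subset)
      then obtain xs where xs: "set xs = s" "distinct xs" using finite_distinct_list by blast
      then obtain n where n: "length xs = Suc n" using False by (cases xs) auto
      have "distinct (map f xs)"
        using xs s * inj_on_subset[of f A s] by (auto simp: distinct_map)
      then show ?thesis using rels[of xs "Simplex n"] xs n s by auto
    qed (use assms in simp)
  qed (use * in auto)
qed

lemma restrict_substruct: "B \<subseteq> univ M \<Longrightarrow> substruct \<lparr>univ = B, rels = \<lambda>s. rels M s \<inter> lists B\<rparr> M"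
  by (simp add: substruct_def)

text \<open>The age consists of structures on natural numbers, so the substructure on
  \<open>B\<close> is copied there, recognised as a member of \<open>KP\<close>, and its simplices
  and order are carried back.\<close>

lemma Fraisse_limit_finite_subset:
  assumes M: "is_Fraisse_limit polyhedron_arity KP M" and B: "finite B" "B \<subseteq> univ M"
  obtains S r where "ordered_polyhedron B S r"
    "\<And>s xs. xs \<in> lists B \<Longrightarrow> xs \<in> rels M s \<longleftrightarrow> xs \<in> polyhedron_rels S r s"
proof -
  obtain f :: "'a \<Rightarrow> nat" and n where f: "inj_on f B"
    using finite_imp_inj_to_nat_seg[OF B(1)] by blast
  define g where "g = inv_into B f"
  have gf: "map g (map f xs) = xs" if "xs \<in> lists B" for xs
    using that f by (induction xs) (auto simp: g_def)
  define N where "N = \<lparr>univ = f ` B, rels = \<lambda>s. map f ` (rels M s \<inter> lists B)\<rparr>"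
  let ?B = "\<lparr>univ = B, rels = \<lambda>s. rels M s \<inter> lists B\<rparr>"
  have wf: "length xs = polyhedron_arity s" if "xs \<in> rels M s" for xs s
    using M that by (auto simp: is_Fraisse_limit_def wf_struct_def)
  have "xs \<in> rels N s \<longleftrightarrow> map g xs \<in> rels ?B s" if "xs \<in> lists (f ` B)" for xs s
  proof -
    obtain ys where "ys \<in> lists B" "xs = map f ys" using \<open>xs \<in> lists (f ` B)\<close> by (auto simp: lists_image)
    then show ?thesis using gf by (auto simp: N_def) (metis gf in_listsI)
  qed
  moreover have "bij_betw g (f ` B) B" unfolding g_def using f by (simp add: bij_betw_inv_into inj_on_imp_bij_betw)
  ultimately have "struct_iso g N ?B" unfolding struct_iso_def by (auto simp: N_def)
  moreover have "wf_struct polyhedron_arity N" using wf by (auto simp: N_def wf_struct_def)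
  ultimately have "N \<in> struct_age polyhedron_arity M"
    using B restrict_substruct[OF B(2)] unfolding struct_age_def isomorphic_structs_def
    by (auto simp: N_def)
  then have "N \<in> KP" using M by (simp add: is_Fraisse_limit_def)
  then obtain A S r where N: "N = polyhedron_struct A S r" and P: "ordered_polyhedron A S r"
    unfolding KP_def by blast
  have A: "A = f ` B" and rN: "rels N s = polyhedron_rels S r s" for s
    using N by (auto simp: N_def polyhedron_struct_def)
  have inj: "inj_on g A" unfolding A g_def by (rule inj_on_inv_into) simp
  have gA: "g ` A = B" using \<open>bij_betw g (f ` B) B\<close> A by (simp add: bij_betw_def)
  show ?thesis
  proof (rule that)
    show "ordered_polyhedron B ((`) g ` S) (map_prod g g ` r)"
      using ordered_polyhedron_image[OF P inj] gA by simp
    fix s xs assume xs: "xs \<in> lists B"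
    have "xs \<in> rels M s \<longleftrightarrow> map f xs \<in> rels N s"
      using xs by (auto simp: N_def) (metis gf in_listsI)
    also have "\<dots> \<longleftrightarrow> map g (map f xs) \<in> polyhedron_rels ((`) g ` S) (map_prod g g ` r) s"
      unfolding rN using xs ordered_polyhedronD[OF P] A
      by (intro map_in_polyhedron_rels_image[OF inj, symmetric]) auto
    finally show "xs \<in> rels M s \<longleftrightarrow> xs \<in> polyhedron_rels ((`) g ` S) (map_prod g g ` r) s"
      using gf[OF xs] by simp
  qed
qed

text \<open>Apart from countability, which is part of being a limit, each axiom of ordered polyhedra
  concerns finitely many points and can be checked in the finite substructure on them.\<close>

lemma Fraisse_limit_polyhedron:
  assumes M: "is_Fraisse_limit polyhedron_arity KP M"
  obtains S r where "ordered_poly (univ M) S r" "rels M = polyhedron_rels S r"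
proof -
  let ?U = "univ M"
  \<comment> \<open>No relation records the empty simplex, so it is added by hand.\<close>
  define S where "S = {s. s = {} \<or> (\<exists>xs n. set xs = s \<and> length xs = Suc n \<and> xs \<in> rels M (Simplex n))}"
  define r where "r = {(x, y). [x, y] \<in> rels M Less}"
  have wf: "length xs = polyhedron_arity s" "set xs \<subseteq> ?U" if "xs \<in> rels M s" for xs s
    using M that by (auto simp: is_Fraisse_limit_def wf_struct_def)
  have SU: "finite s \<and> s \<subseteq> ?U" if "s \<in> S" for s
  proof (cases "s = {}")
    case False
    then obtain xs n where "set xs = s" "xs \<in> rels M (Simplex n)" using \<open>s \<in> S\<close> False unfolding S_def by blast
    then show ?thesis using wf(2) by blast
  qed simp
  have rU: "r \<subseteq> ?U \<times> ?U" using wf(2) by (fastforce simp: r_def)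
  have loc: "\<exists>T t. ordered_polyhedron B T t \<and> (\<forall>s xs. xs \<in> lists B \<longrightarrow> (xs \<in> rels M s \<longleftrightarrow> xs \<in> polyhedron_rels T t s)) \<and>
      (\<forall>s. s \<subseteq> B \<longrightarrow> s \<noteq> {} \<longrightarrow> (s \<in> S \<longleftrightarrow> s \<in> T)) \<and> (\<forall>x\<in>B. \<forall>y\<in>B. (x, y) \<in> r \<longleftrightarrow> (x, y) \<in> t)"
    if B: "finite B" "B \<subseteq> ?U" for B
  proof -
    obtain T t where T: "ordered_polyhedron B T t"
      "\<And>s xs. xs \<in> lists B \<Longrightarrow> xs \<in> rels M s \<longleftrightarrow> xs \<in> polyhedron_rels T t s"
      using Fraisse_limit_finite_subset[OF M B] by blast
    have "s \<in> S \<longleftrightarrow> s \<in> T" if s: "s \<subseteq> B" "s \<noteq> {}" for s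
    proof
      assume "s \<in> S"
      then obtain xs n where xs: "set xs = s" "length xs = Suc n" "xs \<in> rels M (Simplex n)"
        using s(2) by (auto simp: S_def)
      then have "xs \<in> lists B" using s(1) by auto
      then have "xs \<in> polyhedron_rels T t (Simplex n)" using T(2) xs(3) by blast
      then show "s \<in> T" using xs(1) by simp
    next
      assume sT: "s \<in> T"
      obtain xs where xs: "set xs = s" "distinct xs"
        using finite_distinct_list finite_subset[OF s(1) B(1)] by blast
      then obtain n where n: "length xs = Suc n" using s(2) by (cases xs) auto
      have "xs \<in> polyhedron_rels T t (Simplex n)" using xs n sT by simp
      moreover have "xs \<in> lists B" using xs(1) s(1) by auto
      ultimately have "xs \<in> rels M (Simplex n)" using T(2) by blast
      then show "s \<in> S" using xs(1) n by (auto simp: S_def)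
    qed
    moreover have "(x, y) \<in> r \<longleftrightarrow> (x, y) \<in> t" if "x \<in> B" "y \<in> B" for x y
      using T(2)[of "[x, y]" Less] that by (simp add: r_def)
    ultimately show ?thesis using T by blast
  qed
  have her: "u \<in> S" if "v \<in> S" "u \<subseteq> v" for u v
  proof (cases "u = {}")
    case False
    obtain T t where T: "ordered_polyhedron v T t" "\<forall>s. s \<subseteq> v \<longrightarrow> s \<noteq> {} \<longrightarrow> (s \<in> S \<longleftrightarrow> s \<in> T)"
      using loc SU[OF \<open>v \<in> S\<close>] by metis
    then have "v \<in> T" using that False by blast
    then have "u \<in> T" using T(1) \<open>u \<subseteq> v\<close> by (auto simp: ordered_polyhedron_def hereditary_polyhedron_def)
    then show ?thesis using T(2) that False by blast
  qed (simp add: S_def)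
  have single: "{x} \<in> S" if "x \<in> ?U" for x
  proof -
    obtain T t where T: "ordered_polyhedron {x} T t" "\<forall>s. s \<subseteq> {x} \<longrightarrow> s \<noteq> {} \<longrightarrow> (s \<in> S \<longleftrightarrow> s \<in> T)"
      using loc[of "{x}"] \<open>x \<in> ?U\<close> by auto
    then have "\<Union> T = {x}" by (simp add: ordered_polyhedron_def hereditary_polyhedron_def)
    then obtain w where w: "w \<in> T" "x \<in> w" by blast
    then have "w = {x}" using ordered_polyhedronD(1)[OF T(1)] by blast
    then have "{x} \<in> T" using w(1) by simp
    then show ?thesis using T(2) by blast
  qed
  have "\<Union> S = ?U" using single SU by blast
  moreover have "countable ?U" using M by (simp add: is_Fraisse_limit_def)
  ultimately have hp: "hereditary_polyhedron ?U S"
    unfolding hereditary_polyhedron_def using her SU by blast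
  have ord: "\<exists>t. trans t \<and> irrefl t \<and> total_on B t \<and> (\<forall>x\<in>B. \<forall>y\<in>B. (x, y) \<in> r \<longleftrightarrow> (x, y) \<in> t)"
    if "finite B" "B \<subseteq> ?U" for B
    using loc[OF that] by (auto simp: ordered_polyhedron_def strict_linear_order_on_def)
  have "trans r"
  proof (rule transI)
    fix x y z assume xyz: "(x, y) \<in> r" "(y, z) \<in> r"
    then have "{x, y, z} \<subseteq> ?U" using rU by auto
    then obtain t where "trans t" "\<forall>u\<in>{x, y, z}. \<forall>v\<in>{x, y, z}. (u, v) \<in> r \<longleftrightarrow> (u, v) \<in> t"
      using ord[of "{x, y, z}"] by auto
    then show "(x, z) \<in> r" using xyz by (auto dest: transD)
  qed
  moreover have "irrefl r"
  proof (rule irreflI)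
    fix x show "(x, x) \<notin> r"
    proof
      assume x: "(x, x) \<in> r"
      then have "{x} \<subseteq> ?U" using rU by auto
      then obtain t where "irrefl t" "\<forall>u\<in>{x}. \<forall>v\<in>{x}. (u, v) \<in> r \<longleftrightarrow> (u, v) \<in> t"
        using ord[of "{x}"] by auto
      then show False using x by (auto simp: irrefl_def)
    qed
  qed
  moreover have "total_on ?U r"
  proof (rule total_onI)
    fix x y assume xy: "x \<in> ?U" "y \<in> ?U" "x \<noteq> y"
    then obtain t where "total_on {x, y} t" "\<forall>u\<in>{x, y}. \<forall>v\<in>{x, y}. (u, v) \<in> r \<longleftrightarrow> (u, v) \<in> t"
      using ord[of "{x, y}"] by auto
    then show "(x, y) \<in> r \<or> (y, x) \<in> r" using xy by (auto simp: total_on_def)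
  qed
  ultimately have "ordered_polyhedron ?U S r"
    using hp rU by (simp add: ordered_polyhedron_def strict_linear_order_on_def)
  then have "ordered_poly ?U S r" by unfold_locales (auto simp: S_def)
  moreover have "rels M = polyhedron_rels S r"
  proof -
    have "xs \<in> rels M s \<longleftrightarrow> xs \<in> polyhedron_rels S r s" for xs s
    proof (cases s)
      case (Simplex n)
      show ?thesis
      proof (cases "set xs \<subseteq> ?U \<and> xs \<noteq> []")
        case True
        then obtain T t where T: "ordered_polyhedron (set xs) T t"
          "\<forall>s zs. zs \<in> lists (set xs) \<longrightarrow> (zs \<in> rels M s \<longleftrightarrow> zs \<in> polyhedron_rels T t s)"
          "\<forall>s. s \<subseteq> set xs \<longrightarrow> s \<noteq> {} \<longrightarrow> (s \<in> S \<longleftrightarrow> s \<in> T)"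
          using loc[of "set xs"] by (metis List.finite_set)
        then have "set xs \<in> S \<longleftrightarrow> set xs \<in> T" using True by simp
        moreover have "xs \<in> rels M s \<longleftrightarrow> xs \<in> polyhedron_rels T t s" using T(2) by (simp add: in_listsI)
        ultimately show ?thesis using Simplex by simp
      next
        case False
        then show ?thesis using Simplex wf[of xs s] SU[of "set xs"] by auto
      qed
    next
      case Less
      have "\<exists>x y. xs = [x, y]" if "xs \<in> rels M Less"
        using wf(1)[OF that] by (auto simp: length_Suc_conv numeral_2_eq_2)
      then show ?thesis using Less by (auto simp: r_def)
    qed
    then have "rels M s = polyhedron_rels S r s" for s by blast
    then show ?thesis by (simp add: fun_eq_iff)
  qed
  ultimately show ?thesis using that by blast
qed

lemma Fraisse_limit_universal:
  assumes M: "is_Fraisse_limit polyhedron_arity KP M" and S: "rels M = polyhedron_rels S r" "{} \<in> S"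
    and C: "ordered_polyhedron C T t" "finite C" "{} \<in> T"
  shows "\<exists>m. poly_embedding C T t (univ M) S r m"
proof -
  obtain g :: "'b \<Rightarrow> nat" and n where g: "inj_on g C"
    using finite_imp_inj_to_nat_seg[OF C(2)] by blast
  let ?N = "polyhedron_struct (g ` C) ((`) g ` T) (map_prod g g ` t)"
  have "?N \<in> KP" using ordered_polyhedron_image[OF C(1) g] C(2) unfolding KP_def by blast
  then have "?N \<in> struct_age polyhedron_arity M" using M by (simp add: is_Fraisse_limit_def)
  then obtain B h where B: "substruct B M" and h: "struct_iso h ?N B"
    by (auto simp: struct_age_def isomorphic_structs_def)
  have hb: "bij_betw h (g ` C) (univ B)"
    and hr: "\<And>s xs. xs \<in> lists (g ` C) \<Longrightarrow>
      xs \<in> polyhedron_rels ((`) g ` T) (map_prod g g ` t) s \<longleftrightarrow> map h xs \<in> rels B s"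
    using h by (auto simp: struct_iso_def polyhedron_struct_def)
  have "xs \<in> polyhedron_rels T t s \<longleftrightarrow> map (h \<circ> g) xs \<in> polyhedron_rels S r s" if xs: "xs \<in> lists C" for xs s
  proof -
    have gx: "map g xs \<in> lists (g ` C)" using xs by auto
    have "set (map h (map g xs)) \<subseteq> univ B" using xs bij_betw_imp_surj_on[OF hb] by auto
    then have "map h (map g xs) \<in> lists (univ B)" by blast
    then have "map h (map g xs) \<in> rels B s \<longleftrightarrow> map h (map g xs) \<in> rels M s"
      using B by (simp add: substruct_def)
    then show ?thesis
      using hr[OF gx, of s] map_in_polyhedron_rels_image[OF g _ _ xs] ordered_polyhedronD[OF C(1)] S(1)
      by simp
  qed
  moreover have "(h \<circ> g) ` C \<subseteq> univ M"
    using B bij_betw_imp_surj_on[OF hb] by (auto simp: substruct_def)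
  moreover have "inj_on (h \<circ> g) C" using g hb by (intro comp_inj_on) (auto simp: bij_betw_def)
  ultimately have "poly_embedding C T t (univ M) S r (h \<circ> g)"
    unfolding poly_embedding_iff_rels[OF C(2,3) S(2)] by (intro conjI allI ballI)
  then show ?thesis by blast
qed

text \<open>\<open>e\<close> is an isomorphism between the finite substructures on \<open>B\<close>
  and on its image, so ultrahomogeneity applies.\<close>

lemma Fraisse_limit_extend:
  assumes M: "is_Fraisse_limit polyhedron_arity KP M" and S: "rels M = polyhedron_rels S r" "{} \<in> S"
    and B: "finite B" "B \<subseteq> univ M" and e: "poly_embedding B S r (univ M) S r e"
  shows "\<exists>g \<in> automorphisms M. \<forall>x\<in>B. g x = e x"
proof -
  let ?sub = "\<lambda>B. \<lparr>univ = B, rels = \<lambda>s. rels M s \<inter> lists B\<rparr>"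
  have e': "e ` B \<subseteq> univ M" "inj_on e B"
    "\<And>s xs. xs \<in> lists B \<Longrightarrow> xs \<in> rels M s \<longleftrightarrow> map e xs \<in> rels M s"
    using e unfolding poly_embedding_iff_rels[OF B(1) S(2,2)] S(1) by blast+
  have "map e xs \<in> lists (e ` B)" if "xs \<in> lists B" for xs using that by auto
  then have "struct_iso e (?sub B) (?sub (e ` B))"
    unfolding struct_iso_def using e' by (auto simp: bij_betw_def)
  moreover have "ultrahomogeneous M" using M by (simp add: is_Fraisse_limit_def)
  ultimately show ?thesis
    using restrict_substruct[OF B(2)] restrict_substruct[OF e'(1)] B(1)
    unfolding ultrahomogeneous_def
    by (metis (no_types, lifting) finite_imageI rel_struct.select_convs(1))
qed

lemma automorphism_embedding:
  assumes S: "rels M = polyhedron_rels S r" "{} \<in> S" and A: "finite A" "A \<subseteq> univ M"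
    and g: "g \<in> automorphisms M" and B: "g ` A \<subseteq> B"
  shows "poly_embedding A S r B S r g"
proof -
  have "bij_betw g (univ M) (univ M)"
    and "\<And>s xs. xs \<in> lists (univ M) \<Longrightarrow> xs \<in> rels M s \<longleftrightarrow> map g xs \<in> rels M s"
    using g by (auto simp: automorphisms_def struct_iso_def)
  moreover have "lists A \<subseteq> lists (univ M)" using A(2) by (rule lists_mono)
  ultimately show ?thesis
    unfolding poly_embedding_iff_rels[OF A(1) S(2,2)] using B A(2) S(1)
    by (metis bij_betw_imp_inj_on inj_on_subset subsetD)
qed

text \<open>\<open>E\<close> sends \<open>B\<close> into a cube and \<open>m\<close> sends the cube
  into \<open>M\<close>. By ultrahomogeneity their composition agrees on \<open>B\<close> with an
  automorphism \<open>g\<close>, so the monochromatic copy of \<open>B\<close> is its image under an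
  automorphism.\<close>

lemma Fraisse_limit_Ramsey:
  fixes \<kappa> :: "('a \<Rightarrow> 'a) \<Rightarrow> nat"
  assumes M: "is_Fraisse_limit polyhedron_arity KP M" and S: "rels M = polyhedron_rels S r" "ordered_poly (univ M) S r"
    and A: "finite A" "A \<subseteq> univ M" and B: "finite B" "B \<subseteq> univ M" and \<kappa>: "\<And>x. \<kappa> x < n"
  shows "\<exists>g \<in> automorphisms M. \<exists>c. \<forall>j. poly_embedding A S r B S r j \<longrightarrow> \<kappa> (restrict (g \<circ> j) A) = c"
proof -
  interpret ordered_poly "univ M" S r by fact
  obtain N where N: "\<And>\<kappa> :: ('a \<Rightarrow> nat set) \<Rightarrow> nat. (\<forall>x. \<kappa> x < n) \<Longrightarrow>
    (\<exists>E c. poly_embedding B S r (cube_vertices N) (cube_simplices N) (cube_less N) E \<and>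
      (\<forall>j. poly_embedding A S r B S r j \<longrightarrow> \<kappa> (restrict (E \<circ> j) A) = c))"
    using polyhedra_Ramsey[OF A B] by blast
  obtain m where m: "poly_embedding (cube_vertices N) (cube_simplices N) (cube_less N) (univ M) S r m"
    using Fraisse_limit_universal[OF M S(1) empty_simplex cube_ordered_polyhedron[of N]]
    by (auto simp: cube_simplices_def)
  \<comment> \<open>Maps from \<open>A\<close> into the cube inherit their colours from
    \<open>M\<close> along \<open>m\<close>.\<close>
  obtain E c where E: "poly_embedding B S r (cube_vertices N) (cube_simplices N) (cube_less N) E"
    and c: "\<And>j. poly_embedding A S r B S r j \<Longrightarrow> \<kappa> (restrict (m \<circ> restrict (E \<circ> j) A) A) = c"
    using N[of "\<lambda>f. \<kappa> (restrict (m \<circ> f) A)"] \<kappa> by blast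
  obtain g where g: "g \<in> automorphisms M" "\<And>x. x \<in> B \<Longrightarrow> g x = m (E x)"
    using Fraisse_limit_extend[OF M S(1) empty_simplex B poly_embedding_comp[OF E m]] by auto
  have "\<kappa> (restrict (g \<circ> j) A) = c" if j: "poly_embedding A S r B S r j" for j
  proof -
    have "restrict (g \<circ> j) A = restrict (m \<circ> restrict (E \<circ> j) A) A"
      using g(2) poly_embeddingD(1)[OF j] by (auto simp: restrict_def fun_eq_iff)
    then show ?thesis using c[OF j] by simp
  qed
  then show ?thesis using g(1) by blast
qed

section \<open>Automorphism groups and extreme amenability\<close>

lemma automorphismsD:
  assumes "g \<in> automorphisms M"
  shows "g \<in> Bij (univ M)" "bij_betw g (univ M) (univ M)" "\<And>x. x \<in> univ M \<Longrightarrow> g x \<in> univ M"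
    "g \<in> extensional (univ M)"
    "\<And>s xs. xs \<in> lists (univ M) \<Longrightarrow> xs \<in> rels M s \<longleftrightarrow> map g xs \<in> rels M s"
proof -
  show *: "g \<in> Bij (univ M)" "bij_betw g (univ M) (univ M)"
    "\<And>s xs. xs \<in> lists (univ M) \<Longrightarrow> xs \<in> rels M s \<longleftrightarrow> map g xs \<in> rels M s"
    using assms by (auto simp: automorphisms_def struct_iso_def)
  show "\<And>x. x \<in> univ M \<Longrightarrow> g x \<in> univ M" using *(2) by (rule bij_betwE[THEN bspec])
  show "g \<in> extensional (univ M)" using *(1) by (rule Bij_imp_extensional)
qed

lemma automorphismsI:
  assumes "g \<in> Bij (univ M)"
    "\<And>s xs. xs \<in> lists (univ M) \<Longrightarrow> xs \<in> rels M s \<longleftrightarrow> map g xs \<in> rels M s"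
  shows "g \<in> automorphisms M"
  using assms unfolding automorphisms_def struct_iso_def Bij_def by blast

lemma compose_automorphisms:
  assumes g: "g \<in> automorphisms M" and h: "h \<in> automorphisms M"
  shows "compose (univ M) g h \<in> automorphisms M"
proof (rule automorphismsI)
  show "compose (univ M) g h \<in> Bij (univ M)"
    using automorphismsD(1)[OF g] automorphismsD(1)[OF h] by (rule compose_Bij)
  fix s xs assume xs: "xs \<in> lists (univ M)"
  then have "map (compose (univ M) g h) xs = map g (map h xs)"
    by (auto simp: compose_eq)
  moreover have "map h xs \<in> lists (univ M)" using xs automorphismsD(3)[OF h] by auto
  ultimately show "xs \<in> rels M s \<longleftrightarrow> map (compose (univ M) g h) xs \<in> rels M s"
    using automorphismsD(5)[OF g, of "map h xs" s] automorphismsD(5)[OF h xs, of s] by metis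
qed

lemma inv_automorphisms:
  assumes g: "g \<in> automorphisms M"
  shows "restrict (inv_into (univ M) g) (univ M) \<in> automorphisms M" (is "?i \<in> _")
proof (rule automorphismsI)
  show iB: "?i \<in> Bij (univ M)" using automorphismsD(1)[OF g] by (rule restrict_inv_into_Bij)
  fix s xs assume xs: "xs \<in> lists (univ M)"
  then have "map ?i xs \<in> lists (univ M)" using Bij_inv_into_mem[OF automorphismsD(1)[OF g]] by auto
  moreover have "map g (map ?i xs) = xs"
    using xs bij_betw_inv_into_right[OF automorphismsD(2)[OF g]] by (induction xs) auto
  ultimately show "xs \<in> rels M s \<longleftrightarrow> map ?i xs \<in> rels M s"
    using automorphismsD(5)[OF g, of "map ?i xs" s] by simp
qed

lemma id_automorphism: "(\<lambda>x\<in>univ M. x) \<in> automorphisms M"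
proof (rule automorphismsI)
  fix s xs assume "xs \<in> lists (univ M)"
  then have "map (\<lambda>x\<in>univ M. x) xs = xs" by (induction xs) auto
  then show "xs \<in> rels M s \<longleftrightarrow> map (\<lambda>x\<in>univ M. x) xs \<in> rels M s" by simp
qed (rule id_Bij)

lemma subgroup_automorphisms: "subgroup (automorphisms M) (BijGroup (univ M))"
proof (rule group.subgroupI[OF group_BijGroup])
  show "automorphisms M \<subseteq> carrier (BijGroup (univ M))"
    using automorphismsD(1) by (auto simp: BijGroup_def)
  show "automorphisms M \<noteq> {}" using id_automorphism by blast
  show "inv\<^bsub>BijGroup (univ M)\<^esub> g \<in> automorphisms M" if "g \<in> automorphisms M" for g
    unfolding inv_BijGroup[OF automorphismsD(1)[OF that]] using that by (rule inv_automorphisms)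
  show "g \<otimes>\<^bsub>BijGroup (univ M)\<^esub> h \<in> automorphisms M"
    if "g \<in> automorphisms M" "h \<in> automorphisms M" for g h
    using compose_automorphisms[OF that] automorphismsD(1)[OF that(1)] automorphismsD(1)[OF that(2)]
    by (simp add: BijGroup_def)
qed

lemma group_Aut_group: "group (Aut_group M)"
  unfolding Aut_group_def by (rule group.subgroup_imp_group[OF group_BijGroup subgroup_automorphisms])

lemma carrier_Aut_group [simp]: "carrier (Aut_group M) = automorphisms M"
  by (simp add: Aut_group_def)

lemma one_Aut_group: "\<one>\<^bsub>Aut_group M\<^esub> = (\<lambda>x\<in>univ M. x)"
  by (simp add: Aut_group_def BijGroup_def)

lemma mult_Aut_group:
  assumes "g \<in> automorphisms M" "h \<in> automorphisms M"
  shows "g \<otimes>\<^bsub>Aut_group M\<^esub> h = compose (univ M) g h"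
  using automorphismsD(1)[OF assms(1)] automorphismsD(1)[OF assms(2)]
  by (simp add: Aut_group_def BijGroup_def)

lemma inv_Aut_group:
  assumes "g \<in> automorphisms M"
  shows "inv\<^bsub>Aut_group M\<^esub> g = restrict (inv_into (univ M) g) (univ M)"
  unfolding Aut_group_def
    group.m_inv_consistent[OF group_BijGroup subgroup_automorphisms assms]
  by (rule inv_BijGroup[OF automorphismsD(1)[OF assms]])

lemma Aut_group_apply:
  "g \<in> automorphisms M \<Longrightarrow> h \<in> automorphisms M \<Longrightarrow> x \<in> univ M \<Longrightarrow> (g \<otimes>\<^bsub>Aut_group M\<^esub> h) x = g (h x)"
  by (simp add: mult_Aut_group compose_eq)

lemma Aut_group_inv_apply:
  assumes "g \<in> automorphisms M" "x \<in> univ M"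
  shows "g ((inv\<^bsub>Aut_group M\<^esub> g) x) = x" "(inv\<^bsub>Aut_group M\<^esub> g) (g x) = x"
  using assms automorphismsD(3)[OF assms] bij_betw_inv_into_right[OF automorphismsD(2)[OF assms(1)]]
    bij_betw_inv_into_left[OF automorphismsD(2)[OF assms(1)]]
  by (simp_all add: inv_Aut_group)

section \<open>The topology of pointwise convergence\<close>

lemma topspace_pointwise [simp]: "topspace (pointwise_topology M) = automorphisms M"
proof -
  have "automorphisms M \<subseteq> (\<Pi>\<^sub>E x\<in>univ M. univ M)"
    using automorphismsD(3,4) by (auto simp: PiE_def)
  then show ?thesis by (auto simp: pointwise_topology_def)
qed

lemma openin_pointwise:
  assumes "x \<in> univ M"
  shows "openin (pointwise_topology M) {g \<in> automorphisms M. g x = y}"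
proof -
  have "continuous_map (pointwise_topology M) (discrete_topology (univ M)) (\<lambda>g. g x)"
    unfolding pointwise_topology_def
    by (rule continuous_map_from_subtopology, rule continuous_map_product_projection[OF assms])
  moreover have "openin (discrete_topology (univ M)) ({y} \<inter> univ M)" by simp
  ultimately have "openin (pointwise_topology M) {g \<in> topspace (pointwise_topology M). g x \<in> {y} \<inter> univ M}"
    by (rule openin_continuous_map_preimage)
  moreover have "{g \<in> topspace (pointwise_topology M). g x \<in> {y} \<inter> univ M} = {g \<in> automorphisms M. g x = y}"
    using automorphismsD(3) assms by auto
  ultimately show ?thesis by simp
qed

text \<open>The factors of the product are discrete, so continuity means that each evaluation is
  locally constant.\<close>

lemma continuous_map_into_pointwise:
  assumes "\<And>z. z \<in> topspace Z \<Longrightarrow> f z \<in> automorphisms M"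
    and loc: "\<And>x z. x \<in> univ M \<Longrightarrow> z \<in> topspace Z \<Longrightarrow>
      \<exists>W. openin Z W \<and> z \<in> W \<and> (\<forall>w\<in>W. f w x = f z x)"
  shows "continuous_map Z (pointwise_topology M) f"
  unfolding pointwise_topology_def
proof (rule continuous_map_into_subtopology)
  show "continuous_map Z (product_topology (\<lambda>_. discrete_topology (univ M)) (univ M)) f"
    unfolding continuous_map_componentwise
  proof (intro conjI ballI)
    show "f ` topspace Z \<subseteq> extensional (univ M)"
      using assms(1) automorphismsD(4) by blast
  next
    fix x assume x: "x \<in> univ M"
    have "openin Z {z \<in> topspace Z. f z x \<in> V}" for V
    proof (subst openin_subopen, intro ballI)
      fix z assume z: "z \<in> {z \<in> topspace Z. f z x \<in> V}"
      then obtain W where W: "openin Z W" "z \<in> W" "\<forall>w\<in>W. f w x = f z x" using loc[OF x, of z] by auto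
      have "w \<in> {z \<in> topspace Z. f z x \<in> V}" if w: "w \<in> W" for w
      proof -
        have "f w x = f z x" using W(3) w by blast
        then show ?thesis using z openin_subset[OF W(1)] w by auto
      qed
      then show "\<exists>T. openin Z T \<and> z \<in> T \<and> T \<subseteq> {z \<in> topspace Z. f z x \<in> V}" using W by blast
    qed
    moreover have "f z x \<in> univ M" if "z \<in> topspace Z" for z
      using automorphismsD(3)[OF assms(1)[OF that] x] .
    ultimately show "continuous_map Z (discrete_topology (univ M)) (\<lambda>z. f z x)"
      by (auto simp: continuous_map_def)
  qed
  show "f \<in> topspace Z \<rightarrow> automorphisms M" using assms(1) by blast
qed

lemma topological_group_Aut: "topological_group_on (Aut_group M) (pointwise_topology M)"
  unfolding topological_group_on_def
proof (intro conjI)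
  interpret group "Aut_group M" by (rule group_Aut_group)
  let ?T = "pointwise_topology M"
  show "group (Aut_group M)" by (rule group_Aut_group)
  show "topspace ?T = carrier (Aut_group M)" by simp
  show "continuous_map (prod_topology ?T ?T) ?T (\<lambda>(g, h). g \<otimes>\<^bsub>Aut_group M\<^esub> h)"
  proof (rule continuous_map_into_pointwise)
    fix z assume "z \<in> topspace (prod_topology ?T ?T)"
    then show "(case z of (g, h) \<Rightarrow> g \<otimes>\<^bsub>Aut_group M\<^esub> h) \<in> automorphisms M"
      using m_closed by auto
  next
    fix x z assume x: "x \<in> univ M" and z: "z \<in> topspace (prod_topology ?T ?T)"
    then obtain g h where gh: "z = (g, h)" "g \<in> automorphisms M" "h \<in> automorphisms M" by auto
    let ?W = "{g' \<in> automorphisms M. g' (h x) = g (h x)} \<times> {h' \<in> automorphisms M. h' x = h x}"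
    have "openin (prod_topology ?T ?T) ?W"
      using openin_pointwise[OF x] openin_pointwise[OF automorphismsD(3)[OF gh(3) x]]
      by (simp add: openin_prod_Times_iff)
    moreover have "z \<in> ?W" using gh by simp
    moreover have "(case w of (g, h) \<Rightarrow> g \<otimes>\<^bsub>Aut_group M\<^esub> h) x = (case z of (g, h) \<Rightarrow> g \<otimes>\<^bsub>Aut_group M\<^esub> h) x"
      if "w \<in> ?W" for w
      using that gh x by (auto simp: Aut_group_apply)
    ultimately show "\<exists>W. openin (prod_topology ?T ?T) W \<and> z \<in> W \<and>
        (\<forall>w\<in>W. (case w of (g, h) \<Rightarrow> g \<otimes>\<^bsub>Aut_group M\<^esub> h) x = (case z of (g, h) \<Rightarrow> g \<otimes>\<^bsub>Aut_group M\<^esub> h) x)"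
      by blast
  qed
  show "continuous_map ?T ?T (\<lambda>g. inv\<^bsub>Aut_group M\<^esub> g)"
  proof (rule continuous_map_into_pointwise)
    fix g assume "g \<in> topspace ?T"
    then show "inv\<^bsub>Aut_group M\<^esub> g \<in> automorphisms M" using inv_closed by simp
  next
    fix x g assume x: "x \<in> univ M" and "g \<in> topspace ?T"
    then have g: "g \<in> automorphisms M" by simp
    \<comment> \<open>The inverse of \<open>h\<close> sends \<open>x\<close> to \<open>y\<close> as
      soon as \<open>h\<close> sends \<open>y\<close> to \<open>x\<close>; so the value at
      \<open>x\<close> of the inverse is constant on an evaluation neighbourhood of
      \<open>g\<close>.\<close>
    define y where "y = (inv\<^bsub>Aut_group M\<^esub> g) x"
    have "inv\<^bsub>Aut_group M\<^esub> g \<in> automorphisms M" using inv_closed g by simp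
    then have y: "y \<in> univ M" unfolding y_def using x by (rule automorphismsD(3))
    have "openin ?T {h \<in> automorphisms M. h y = x}" using y by (rule openin_pointwise)
    moreover have "g \<in> {h \<in> automorphisms M. h y = x}"
      using g x by (simp add: y_def Aut_group_inv_apply)
    moreover have "(inv\<^bsub>Aut_group M\<^esub> h) x = y" if "h \<in> {h \<in> automorphisms M. h y = x}" for h
      using that Aut_group_inv_apply(2)[of h M y] y by auto
    ultimately show "\<exists>W. openin ?T W \<and> g \<in> W \<and>
        (\<forall>w\<in>W. (inv\<^bsub>Aut_group M\<^esub> w) x = (inv\<^bsub>Aut_group M\<^esub> g) x)"
      unfolding y_def by blast
  qed
qed

text \<open>A basic open set of the product restricts only finitely many coordinates;
  \<open>A\<close> consists of these, and an automorphism fixing them satisfies all restrictions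
  because the identity does.\<close>

lemma pointwise_neighbourhood_of_one:
  assumes W: "openin (pointwise_topology M) W" "\<one>\<^bsub>Aut_group M\<^esub> \<in> W"
  obtains A where "finite A" "A \<subseteq> univ M" "\<And>g. g \<in> automorphisms M \<Longrightarrow> (\<And>a. a \<in> A \<Longrightarrow> g a = a) \<Longrightarrow> g \<in> W"
proof -
  let ?P = "product_topology (\<lambda>_. discrete_topology (univ M)) (univ M)"
  obtain V where V: "openin ?P V" "W = V \<inter> automorphisms M"
    using W(1) by (auto simp: pointwise_topology_def openin_subtopology)
  then have "(\<lambda>x\<in>univ M. x) \<in> V" using W(2) by (simp add: one_Aut_group)
  then obtain X where X: "(\<lambda>x\<in>univ M. x) \<in> (\<Pi>\<^sub>E x\<in>univ M. X x)"
    "finite {x. X x \<noteq> univ M}" "(\<Pi>\<^sub>E x\<in>univ M. X x) \<subseteq> V"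
    using product_topology_open_contains_basis[OF V(1)] by (metis (no_types, lifting) topspace_discrete_topology Collect_cong)
  show ?thesis
  proof (rule that)
    show "finite {x \<in> univ M. X x \<noteq> univ M}" using X(2) by (rule rev_finite_subset) auto
    show "{x \<in> univ M. X x \<noteq> univ M} \<subseteq> univ M" by blast
    fix g assume g: "g \<in> automorphisms M" and fixed: "\<And>a. a \<in> {x \<in> univ M. X x \<noteq> univ M} \<Longrightarrow> g a = a"
    have "g x \<in> X x" if x: "x \<in> univ M" for x
    proof (cases "X x = univ M")
      case True
      then show ?thesis using automorphismsD(3)[OF g x] by simp
    next
      case False
      then have "g x = x" using fixed x by blast
      then show ?thesis using X(1) x by (metis PiE_mem restrict_apply')
    qed
    then have "g \<in> (\<Pi>\<^sub>E x\<in>univ M. X x)" using automorphismsD(4)[OF g] by (simp add: PiE_iff)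
    then show "g \<in> W" using X(3) V(2) g by blast
  qed
qed

text \<open>If no point is fixed, compactness gives finitely many open sets \<open>U\<close> with \<open>h U\<close> disjoint from
  \<open>U\<close>. The colouring of \<open>g\<close> by the set in which \<open>g x\<^sub>0\<close> lies depends only on \<open>g\<inverse>\<close> restricted to a
  finite set \<open>A\<close>, up to shrinking these sets, and a colour class containing both \<open>g\<close> and \<open>h g\<close> is
  impossible.\<close>

lemma Ramsey_imp_fixed_point:
  fixes M :: "('s, 'a) rel_struct" and X :: "'x topology"
  assumes Ramsey: "\<And>A B n (\<kappa> :: ('a \<Rightarrow> 'a) \<Rightarrow> nat).
      finite A \<Longrightarrow> A \<subseteq> univ M \<Longrightarrow> finite B \<Longrightarrow> B \<subseteq> univ M \<Longrightarrow> (\<And>x. \<kappa> x < n) \<Longrightarrow>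
      \<exists>g \<in> automorphisms M. \<exists>c. \<forall>j \<in> automorphisms M. j ` A \<subseteq> B \<longrightarrow> \<kappa> (restrict (g \<circ> j) A) = c"
    and X: "compact_space X" "Hausdorff_space X" "topspace X \<noteq> {}"
    and act: "continuous_action (Aut_group M) (pointwise_topology M) X \<phi>"
  shows "\<exists>x \<in> topspace X. \<forall>g \<in> automorphisms M. \<phi> g x = x"
proof (rule ccontr)
  let ?G = "Aut_group M" and ?T = "pointwise_topology M"
  assume no_fix: "\<not> ?thesis"
  interpret group ?G by (rule group_Aut_group)
  interpret group_action ?G "topspace X" \<phi>
    using act by (simp add: continuous_action_def)
  have cont: "continuous_map (prod_topology ?T X) X (\<lambda>(g, x). \<phi> g x)"
    using act by (simp add: continuous_action_def)
  have \<phi>_in: "\<phi> g x \<in> topspace X" if "g \<in> automorphisms M" "x \<in> topspace X" for g x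
    using that element_image[of g x] by simp
  have \<phi>_mult: "\<phi> (g \<otimes>\<^bsub>?G\<^esub> h) x = \<phi> g (\<phi> h x)"
    if "g \<in> automorphisms M" "h \<in> automorphisms M" "x \<in> topspace X" for g h x
    using that composition_rule by simp
  have \<phi>_one: "\<phi> \<one>\<^bsub>?G\<^esub> x = x" if "x \<in> topspace X" for x
    using that id_eq_one by (metis restrict_apply')
  have inv_in: "inv\<^bsub>?G\<^esub> g \<in> automorphisms M" if "g \<in> automorphisms M" for g
    using that inv_closed[of g] by simp
  have mult_in: "g \<otimes>\<^bsub>?G\<^esub> h \<in> automorphisms M" if "g \<in> automorphisms M" "h \<in> automorphisms M" for g h
    using that m_closed[of g h] by simp
  have one_in: "\<one>\<^bsub>?G\<^esub> \<in> automorphisms M" using one_closed by simp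
  \<comment> \<open>\<open>V\<close> is used for colouring and \<open>U\<close> is the enlarged set.
    If \<open>p\<close> moves a point into \<open>V\<close> and \<open>q\<close> has the same
    inverse as \<open>p\<close> on \<open>A\<close>, then \<open>q\<close> composed with the inverse
    of \<open>p\<close> fixes \<open>A\<close> pointwise, so \<open>q\<close> moves that point into
    \<open>U\<close>.\<close>
  define R where "R x h V A U \<longleftrightarrow> h \<in> automorphisms M \<and> openin X V \<and> x \<in> V \<and> finite A \<and> A \<subseteq> univ M \<and>
      (\<forall>g \<in> automorphisms M. (\<forall>a\<in>A. g a = a) \<longrightarrow> (\<forall>y\<in>V. \<phi> g y \<in> U)) \<and> (\<forall>y\<in>U. \<phi> h y \<notin> U)"
    for x h V A U
  have "\<exists>h V A U. R x h V A U" if x: "x \<in> topspace X" for x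
  proof -
    obtain h where h: "h \<in> automorphisms M" "\<phi> h x \<noteq> x" using no_fix x by blast
    obtain P Q where PQ: "openin X P" "openin X Q" "x \<in> P" "\<phi> h x \<in> Q" "disjnt P Q"
      using X(2) x \<phi>_in[OF h(1) x] h(2) unfolding Hausdorff_space_def by metis
    have "continuous_map X (prod_topology ?T X) (\<lambda>y. (h, y))"
      using h(1) by (simp add: continuous_map_pairedI)
    then have "continuous_map X X ((\<lambda>(g, x). \<phi> g x) \<circ> (\<lambda>y. (h, y)))"
      using cont by (rule continuous_map_compose)
    then have ch: "continuous_map X X (\<phi> h)" by (simp add: comp_def)
    \<comment> \<open>\<open>\<phi> h\<close> maps \<open>U\<close> into \<open>Q\<close>, which
      misses \<open>P\<close> and hence \<open>U\<close>.\<close>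
    define U where "U = P \<inter> {y \<in> topspace X. \<phi> h y \<in> Q}"
    have U: "openin X U" unfolding U_def
      using PQ(1) openin_continuous_map_preimage[OF ch PQ(2)] by (rule openin_Int)
    have xU: "x \<in> U" using PQ x by (simp add: U_def)
    have disj: "\<forall>y\<in>U. \<phi> h y \<notin> U" using PQ(5) by (auto simp: U_def disjnt_def)
    have "openin (prod_topology ?T X) {z \<in> topspace (prod_topology ?T X). (\<lambda>(g, x). \<phi> g x) z \<in> U}"
      (is "openin _ ?pre") using cont U by (rule openin_continuous_map_preimage)
    moreover have "(\<one>\<^bsub>?G\<^esub>, x) \<in> ?pre" using x xU one_in \<phi>_one by simp
    ultimately obtain W V where WV: "openin ?T W" "openin X V" "\<one>\<^bsub>?G\<^esub> \<in> W" "x \<in> V" "W \<times> V \<subseteq> ?pre"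
      unfolding openin_prod_topology_alt by meson
    obtain A where A: "finite A" "A \<subseteq> univ M"
      "\<And>g. g \<in> automorphisms M \<Longrightarrow> (\<And>a. a \<in> A \<Longrightarrow> g a = a) \<Longrightarrow> g \<in> W"
      using pointwise_neighbourhood_of_one[OF WV(1,3)] by blast
    have "\<phi> g y \<in> U" if "g \<in> automorphisms M" "\<forall>a\<in>A. g a = a" "y \<in> V" for g y
      using A(3)[of g] that WV(5) by auto
    then show ?thesis using h(1) WV(2,4) A(1,2) disj unfolding R_def by blast
  qed
  then obtain h V A U where "\<And>x. x \<in> topspace X \<Longrightarrow> R x (h x) (V x) (A x) (U x)" by metis
  then have h: "\<And>x. x \<in> topspace X \<Longrightarrow> h x \<in> automorphisms M"
    and V: "\<And>x. x \<in> topspace X \<Longrightarrow> openin X (V x) \<and> x \<in> V x"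
    and A: "\<And>x. x \<in> topspace X \<Longrightarrow> finite (A x) \<and> A x \<subseteq> univ M"
    and VU: "\<And>x g y. x \<in> topspace X \<Longrightarrow> g \<in> automorphisms M \<Longrightarrow> (\<forall>a\<in>A x. g a = a) \<Longrightarrow> y \<in> V x \<Longrightarrow> \<phi> g y \<in> U x"
    and hU: "\<And>x y. x \<in> topspace X \<Longrightarrow> y \<in> U x \<Longrightarrow> \<phi> (h x) y \<notin> U x"
    unfolding R_def by blast+
  have "(\<forall>W \<in> V ` topspace X. openin X W) \<and> topspace X \<subseteq> \<Union> (V ` topspace X)" using V by blast
  then obtain \<F> where "finite \<F>" "\<F> \<subseteq> V ` topspace X" "topspace X \<subseteq> \<Union> \<F>"
    using X(1) unfolding compact_space_alt by meson
  then obtain F where F: "finite F" "F \<subseteq> topspace X" "topspace X \<subseteq> \<Union> (V ` F)"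
    by (metis finite_subset_image)
  define A' where "A' = (\<Union>x\<in>F. A x)"
  define H where "H = insert \<one>\<^bsub>?G\<^esub> (h ` F)"
  \<comment> \<open>\<open>B\<close> receives \<open>A'\<close> under the inverse of every
    \<open>k \<in> H\<close>, so the Ramsey property compares the colours of all these inverses.
    Which displacing element \<open>h x\<close> will be needed depends on the colour obtained, so
    \<open>H\<close> contains those of all \<open>x \<in> F\<close>, besides the identity.\<close>
  define B where "B = (\<Union>k\<in>H. (inv\<^bsub>?G\<^esub> k) ` A')"
  have A': "finite A'" "A' \<subseteq> univ M" using F A by (auto simp: A'_def)
  have H: "finite H" "H \<subseteq> automorphisms M" using F h one_in by (auto simp: H_def)
  have "(inv\<^bsub>?G\<^esub> k) ` A' \<subseteq> univ M" if "k \<in> H" for k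
    using automorphismsD(3)[OF inv_in] that H(2) A'(2) by blast
  then have B: "finite B" "B \<subseteq> univ M" using H(1) A'(1) by (auto simp: B_def)
  obtain x0 where x0: "x0 \<in> topspace X" using X(3) by blast
  define P where "P f x \<longleftrightarrow> x \<in> F \<and> (\<exists>g \<in> automorphisms M.
    (\<forall>v\<in>A'. (inv\<^bsub>?G\<^esub> g) v = f v) \<and> \<phi> g x0 \<in> V x)" for f x
  have "F \<noteq> {}" using F(3) x0 by auto
  then obtain x1 where x1: "x1 \<in> F" by blast
  \<comment> \<open>The map \<open>f\<close> represents the inverse of a group element on
    \<open>A'\<close>. The colour must be chosen from \<open>f\<close> alone, although different
    elements with this inverse may move \<open>x0\<close> to different places. The default
    \<open>x1\<close> covers maps for which no \<open>x\<close> qualifies.\<close>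
  define \<kappa> where "\<kappa> f = (if \<exists>x. P f x then SOME x. P f x else x1)" for f
  have \<kappa>F: "\<kappa> f \<in> F" for f
    using x1 someI_ex[of "P f"] by (auto simp: \<kappa>_def P_def)
  obtain code :: "'x \<Rightarrow> nat" and n where code: "inj_on code F" "\<And>x. x \<in> F \<Longrightarrow> code x < n"
    using finite_colours_nat[OF F(1)] by blast
  have "\<exists>g \<in> automorphisms M. \<exists>c. \<forall>j \<in> automorphisms M. j ` A' \<subseteq> B \<longrightarrow>
      code (\<kappa> (restrict (g \<circ> j) A')) = c"
    by (rule Ramsey[OF A' B]) (rule code(2)[OF \<kappa>F])
  then obtain g c where g: "g \<in> automorphisms M" and
    c: "\<And>j. j \<in> automorphisms M \<Longrightarrow> j ` A' \<subseteq> B \<Longrightarrow> code (\<kappa> (restrict (g \<circ> j) A')) = c"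
    by blast
  define z where "z = \<kappa> (restrict (g \<circ> inv\<^bsub>?G\<^esub> \<one>\<^bsub>?G\<^esub>) A')"
  have zF: "z \<in> F" by (simp add: z_def \<kappa>F)
  then have zX: "z \<in> topspace X" using F(2) by blast
  \<comment> \<open>The elements \<open>k\<close> times the inverse of \<open>g\<close>, for
    \<open>k \<in> H\<close>, have inverses that share the colour \<open>z\<close> on
    \<open>A'\<close>. So all of them move \<open>x0\<close> into \<open>U z\<close>; the cases
    \<open>k = 1\<close> and \<open>k = h z\<close> together contradict the choice of
    \<open>h z\<close>.\<close>
  have key: "\<phi> (k \<otimes>\<^bsub>?G\<^esub> inv\<^bsub>?G\<^esub> g) x0 \<in> U z" if k: "k \<in> H" for k
  proof -
    have ka: "k \<in> automorphisms M" using k H(2) by blast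
    have code_c: "code (\<kappa> (restrict (g \<circ> inv\<^bsub>?G\<^esub> k) A')) = c" if "k \<in> H" for k
    proof (rule c)
      show "inv\<^bsub>?G\<^esub> k \<in> automorphisms M" using that H(2) inv_in by blast
      show "(inv\<^bsub>?G\<^esub> k) ` A' \<subseteq> B" using that by (auto simp: B_def)
    qed
    let ?f = "restrict (g \<circ> inv\<^bsub>?G\<^esub> k) A'" and ?q = "k \<otimes>\<^bsub>?G\<^esub> inv\<^bsub>?G\<^esub> g"
    have "code (\<kappa> ?f) = code z" unfolding z_def using code_c[OF k] code_c[of "\<one>\<^bsub>?G\<^esub>"] by (simp add: H_def)
    then have \<kappa>z: "\<kappa> ?f = z" using inj_onD[OF code(1)] \<kappa>F zF by blast
    have q: "?q \<in> automorphisms M" using ka g inv_in mult_in by blast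
    have "inv\<^bsub>?G\<^esub> ?q = g \<otimes>\<^bsub>?G\<^esub> inv\<^bsub>?G\<^esub> k" using ka g inv_in by (simp add: inv_mult_group)
    then have invq: "(inv\<^bsub>?G\<^esub> ?q) v = ?f v" if "v \<in> A'" for v
      using that A'(2) g inv_in[OF ka] by (auto simp: Aut_group_apply)
    obtain x where "x \<in> F" "\<phi> ?q x0 \<in> V x" using F(3) \<phi>_in[OF q x0] by blast
    then have "\<exists>x. P ?f x" using q invq unfolding P_def by blast
    then have "P ?f z" using \<kappa>z someI_ex[of "P ?f"] by (simp add: \<kappa>_def)
    then obtain p where p: "p \<in> automorphisms M" "\<And>v. v \<in> A' \<Longrightarrow> (inv\<^bsub>?G\<^esub> p) v = ?f v" "\<phi> p x0 \<in> V z"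
      unfolding P_def by blast
    have ip: "inv\<^bsub>?G\<^esub> p \<in> automorphisms M" using inv_in p(1) by blast
    have "(?q \<otimes>\<^bsub>?G\<^esub> inv\<^bsub>?G\<^esub> p) v = v" if "v \<in> A z" for v
    proof -
      have v: "v \<in> A'" "v \<in> univ M" using that zF A'(2) by (auto simp: A'_def)
      have "(?q \<otimes>\<^bsub>?G\<^esub> inv\<^bsub>?G\<^esub> p) v = ?q ((inv\<^bsub>?G\<^esub> p) v)" using Aut_group_apply[OF q ip v(2)] .
      also have "\<dots> = ?q ((inv\<^bsub>?G\<^esub> ?q) v)" using p(2)[OF v(1)] invq[OF v(1)] by simp
      also have "\<dots> = v" using Aut_group_inv_apply(1)[OF q v(2)] .
      finally show ?thesis .
    qed
    then have "\<phi> (?q \<otimes>\<^bsub>?G\<^esub> inv\<^bsub>?G\<^esub> p) (\<phi> p x0) \<in> U z"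
      using VU[OF zX mult_in[OF q ip] _ p(3)] by blast
    moreover have "\<phi> (?q \<otimes>\<^bsub>?G\<^esub> inv\<^bsub>?G\<^esub> p) (\<phi> p x0) = \<phi> ?q x0"
    proof -
      have "\<phi> (?q \<otimes>\<^bsub>?G\<^esub> inv\<^bsub>?G\<^esub> p) (\<phi> p x0) = \<phi> (?q \<otimes>\<^bsub>?G\<^esub> inv\<^bsub>?G\<^esub> p \<otimes>\<^bsub>?G\<^esub> p) x0"
        using \<phi>_mult[OF mult_in[OF q ip] p(1) x0] by simp
      also have "?q \<otimes>\<^bsub>?G\<^esub> inv\<^bsub>?G\<^esub> p \<otimes>\<^bsub>?G\<^esub> p = ?q"
        using q ip p(1) by (simp add: m_assoc)
      finally show ?thesis .
    qed
    ultimately show ?thesis by simp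
  qed
  have ig: "inv\<^bsub>?G\<^esub> g \<in> automorphisms M" using inv_in g by blast
  have "\<phi> (inv\<^bsub>?G\<^esub> g) x0 \<in> U z" using key[of "\<one>\<^bsub>?G\<^esub>"] ig by (simp add: H_def)
  moreover have "\<phi> (h z) (\<phi> (inv\<^bsub>?G\<^esub> g) x0) \<in> U z"
    using key[of "h z"] zF \<phi>_mult[OF h[OF zX] ig x0] by (simp add: H_def)
  ultimately show False using hU[OF zX] by blast
qed

theorem corollary4p3p4:
  fixes M :: "(polyhedron_symbol, 'a) rel_struct"
  assumes "is_Fraisse_limit polyhedron_arity KP M"
  shows "extremely_amenable TYPE('x) (Aut_group M) (pointwise_topology M)"
proof -
  obtain S r where S: "ordered_poly (univ M) S r" "rels M = polyhedron_rels S r"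
    using Fraisse_limit_polyhedron[OF assms] by blast
  have "{} \<in> S" using S(1) by (rule ordered_poly.empty_simplex)
  have Ramsey: "\<exists>g \<in> automorphisms M. \<exists>c. \<forall>j \<in> automorphisms M. j ` A \<subseteq> B \<longrightarrow> \<kappa> (restrict (g \<circ> j) A) = c"
    if A: "finite A" "A \<subseteq> univ M" and B: "finite B" "B \<subseteq> univ M" and \<kappa>: "\<And>x. \<kappa> x < n"
    for A B n and \<kappa> :: "('a \<Rightarrow> 'a) \<Rightarrow> nat"
  proof -
    have "\<exists>g \<in> automorphisms M. \<exists>c. \<forall>j. poly_embedding A S r B S r j \<longrightarrow> \<kappa> (restrict (g \<circ> j) A) = c"
      by (rule Fraisse_limit_Ramsey[OF assms S(2,1) A B]) (rule \<kappa>)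
    then obtain g c where g: "g \<in> automorphisms M"
      "\<And>j. poly_embedding A S r B S r j \<Longrightarrow> \<kappa> (restrict (g \<circ> j) A) = c"
      by blast
    have "\<kappa> (restrict (g \<circ> j) A) = c" if "j \<in> automorphisms M" "j ` A \<subseteq> B" for j
      using automorphism_embedding[OF S(2) \<open>{} \<in> S\<close> A that] by (rule g(2))
    then show ?thesis using g(1) by blast
  qed
  show ?thesis
    unfolding extremely_amenable_def
  proof (intro conjI allI impI)
    show "topological_group_on (Aut_group M) (pointwise_topology M)" by (rule topological_group_Aut)
    fix X :: "'x topology" and \<phi>
    assume X: "compact_space X \<and> Hausdorff_space X \<and> topspace X \<noteq> {} \<and>
      continuous_action (Aut_group M) (pointwise_topology M) X \<phi>"
    have "\<exists>x \<in> topspace X. \<forall>g \<in> automorphisms M. \<phi> g x = x"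
      by (rule Ramsey_imp_fixed_point[OF Ramsey]) (assumption | use X in simp)+
    then show "\<exists>x \<in> topspace X. \<forall>g \<in> carrier (Aut_group M). \<phi> g x = x" by simp
  qed
qed

end
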